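(* Let $(A,\mu,\Delta,\alpha,R)$ be a cobraided Hom-bialgebra over $\mathbf{k}$ with an $\alpha$-invariant Hom-cobraiding form $R$, and let $(V,\alpha_V)$ be an $A$-comodule with structure map $\rho_V(v)=\sum v_A\otimes v_V$. Then the map $B_{V,V}\colon V^{\otimes 2}\to V^{\otimes 2}$ defined by $$B_{V,V}(v\otimes w)=\sum R(w_A\otimes v_A)\,w_V\otimes v_V\qquad(v,w\in V)$$ is a solution of the Hom-Yang-Baxter equation for $(V,\alpha_V)$.
   Context: $\mathbf{k}$ is a fixed associative and commutative ring of characteristic $0$; modules, tensor products and linear maps are over $\mathbf{k}$. Write $\Delta(x)=\sum x_1\otimes x_2$ (Sweedler) and $xy=\mu(x,y)$. A Hom-bialgebra $(A,\mu,\Delta,\alpha)$ consists of a $\mathbf{k}$-module $A$, a bilinear map $\mu\colon A^{\otimes 2}\to A$, a linear map $\Delta\colon A\to A^{\otimes 2}$ and a linear map $\alpha\colon A\to A$ such that $\alpha\circ\mu=\mu\circ\alpha^{\otimes 2}$, $\mu\circ(\alpha\otimes\mu)=\mu\circ(\mu\otimes\alpha)$, $\alpha^{\otimes 2}\circ\Delta=\Delta\circ\alpha$, $(\alpha\otimes\Delta)\circ\Delta=(\Delta\otimes\alpha)\circ\Delta$, and $\Delta(ab)=\sum a_1b_1\otimes a_2b_2$ for all $a,b\in A$. No unit or counit is required. A cobraided Hom-bialgebra $(A,\mu,\Delta,\alpha,R)$ is a Hom-bialgebra $(A,\mu,\Delta,\alpha)$ with a bilinear form $R\in\mathrm{Hom}(A^{\otimes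 2},\mathbf{k})$ (the Hom-cobraiding form) such that for all $x,y,z\in A$: (1) $R(xy\otimes\alpha(z))=\sum R(\alpha(x)\otimes z_1)R(\alpha(y)\otimes z_2)$; (2) $R(\alpha(x)\otimes yz)=\sum R(x_1\otimes\alpha(z))R(x_2\otimes\alpha(y))$; (3) $\sum y_1x_1R(x_2\otimes y_2)=\sum R(x_1\otimes y_1)x_2y_2$. $R$ is $\alpha$-invariant if $R=R\circ\alpha^{\otimes 2}$. An $A$-comodule is a pair $(M,\alpha_M)$ of a $\mathbf{k}$-module $M$ and a linear map $\alpha_M\colon M\to M$, together with a linear map $\rho\colon M\to A\otimes M$ such that $(\Delta\otimes\alpha_M)\circ\rho=(\alpha\otimes\rho)\circ\rho$ and $(\alpha\otimes\alpha_M)\circ\rho=\rho\circ\alpha_M$. For a $\mathbf{k}$-module $V$ and linear map $\alpha_V\colon V\to V$, a linear map $B\colon V^{\otimes 2}\to V^{\otimes 2}$ is a solution of the Hom-Yang-Baxter equation (HYBE) for $(V,\alpha_V)$ if $B\circ\alpha_V^{\otimes 2}=\alpha_V^{\otimes 2}\circ B$ and $(\alpha_V\otimes B)\circ(B\otimes\alpha_V)\circ(\alpha_V\otimes B)=(B\otimes\alpha_V)\circ(\alpha_V\otimes B)\circ(B\otimes\alpha_V)$. *)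

theory Defs
  imports "HOL-Algebra.Module" "HOL-Algebra.AbelCoset"
begin

text \<open>
  The distribution has no tensor products of modules over a commutative ring, so they are built
  here in the usual way, as a quotient of a free module. Modules are the records of
  \<^theory>\<open>HOL-Algebra.Module\<close>; their fields for multiplication and one play no role
  here and are left undefined in free and quotient modules.
\<close>

section \<open>Linear and bilinear maps\<close>

locale cring_char_0 = cring R for R (structure) +
  assumes char_0: "\<And>n::nat. n > 0 \<Longrightarrow> [n] \<cdot> \<one> \<noteq> \<zero>"

definition lin_maps ::
  "('r, 'c) ring_scheme \<Rightarrow> ('r, 'm, 'd) module_scheme \<Rightarrow> ('r, 'n, 'e) module_scheme \<Rightarrow> ('m \<Rightarrow> 'n) set"
  where "lin_maps R M N = {f \<in> carrier M \<rightarrow> carrier N.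
    (\<forall>x\<in>carrier M. \<forall>y\<in>carrier M. f (x \<oplus>\<^bsub>M\<^esub> y) = f x \<oplus>\<^bsub>N\<^esub> f y) \<and>
    (\<forall>r\<in>carrier R. \<forall>x\<in>carrier M. f (r \<odot>\<^bsub>M\<^esub> x) = r \<odot>\<^bsub>N\<^esub> f x)}"

definition bilinear_map ::
  "('r, 'c) ring_scheme \<Rightarrow> ('r, 'm, 'd) module_scheme \<Rightarrow> ('r, 'n, 'e) module_scheme \<Rightarrow>
   ('r, 'p, 'f) module_scheme \<Rightarrow> ('m \<Rightarrow> 'n \<Rightarrow> 'p) \<Rightarrow> bool"
  where "bilinear_map R M N P b \<longleftrightarrow>
    (\<forall>x\<in>carrier M. (\<lambda>y. b x y) \<in> lin_maps R N P) \<and>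
    (\<forall>y\<in>carrier N. (\<lambda>x. b x y) \<in> lin_maps R M P)"

definition ring_as_module :: "('r, 'c) ring_scheme \<Rightarrow> ('r, 'r) module"
  where "ring_as_module R = \<lparr>carrier = carrier R, mult = mult R, one = one R,
    zero = zero R, add = add R, smult = mult R\<rparr>"

section \<open>Free modules, generated submodules, quotient modules\<close>

definition free_module :: "('r, 'c) ring_scheme \<Rightarrow> 's set \<Rightarrow> ('r, 's \<Rightarrow> 'r) module"
  where "free_module R S = \<lparr>
    carrier = {f. (\<forall>s. f s \<in> carrier R) \<and> (\<forall>s. s \<notin> S \<longrightarrow> f s = \<zero>\<^bsub>R\<^esub>) \<and> finite {s. f s \<noteq> \<zero>\<^bsub>R\<^esub>}},
    mult = undefined, one = undefined,
    zero = (\<lambda>_. \<zero>\<^bsub>R\<^esub>), add = (\<lambda>f g s. f s \<oplus>\<^bsub>R\<^esub> g s), smult = (\<lambda>r f s. r \<otimes>\<^bsub>R\<^esub> f s)\<rparr>"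

definition free_gen :: "('r, 'c) ring_scheme \<Rightarrow> 's \<Rightarrow> 's \<Rightarrow> 'r"
  where "free_gen R s = (\<lambda>t. if t = s then \<one>\<^bsub>R\<^esub> else \<zero>\<^bsub>R\<^esub>)"

definition gen_submodule ::
  "('r, 'c) ring_scheme \<Rightarrow> ('r, 'm, 'd) module_scheme \<Rightarrow> 'm set \<Rightarrow> 'm set"
  where "gen_submodule R M X = \<Inter>{H. submodule H R M \<and> X \<subseteq> H}"

definition quot_module ::
  "('r, 'm, 'd) module_scheme \<Rightarrow> 'm set \<Rightarrow> ('r, 'm set) module"
  where "quot_module M H = \<lparr>carrier = a_rcosets\<^bsub>M\<^esub> H, mult = undefined, one = undefined,
    zero = H, add = set_add M, smult = (\<lambda>r X. \<Union>x\<in>X. H +>\<^bsub>M\<^esub> (r \<odot>\<^bsub>M\<^esub> x))\<rparr>"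

section \<open>Tensor products\<close>

definition tensor_rels ::
  "('r, 'c) ring_scheme \<Rightarrow> ('r, 'm, 'd) module_scheme \<Rightarrow> ('r, 'n, 'e) module_scheme \<Rightarrow> ('m \<times> 'n \<Rightarrow> 'r) set"
  where "tensor_rels R M N = (let F = free_module R (carrier M \<times> carrier N); \<delta> = free_gen R in
    {\<delta> (x \<oplus>\<^bsub>M\<^esub> x', y) \<ominus>\<^bsub>F\<^esub> (\<delta> (x, y) \<oplus>\<^bsub>F\<^esub> \<delta> (x', y)) | x x' y.
        x \<in> carrier M \<and> x' \<in> carrier M \<and> y \<in> carrier N} \<union>
    {\<delta> (x, y \<oplus>\<^bsub>N\<^esub> y') \<ominus>\<^bsub>F\<^esub> (\<delta> (x, y) \<oplus>\<^bsub>F\<^esub> \<delta> (x, y')) | x y y'.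
        x \<in> carrier M \<and> y \<in> carrier N \<and> y' \<in> carrier N} \<union>
    {\<delta> (r \<odot>\<^bsub>M\<^esub> x, y) \<ominus>\<^bsub>F\<^esub> (r \<odot>\<^bsub>F\<^esub> \<delta> (x, y)) | r x y.
        r \<in> carrier R \<and> x \<in> carrier M \<and> y \<in> carrier N} \<union>
    {\<delta> (x, r \<odot>\<^bsub>N\<^esub> y) \<ominus>\<^bsub>F\<^esub> (r \<odot>\<^bsub>F\<^esub> \<delta> (x, y)) | r x y.
        r \<in> carrier R \<and> x \<in> carrier M \<and> y \<in> carrier N})"

definition tensor_null ::
  "('r, 'c) ring_scheme \<Rightarrow> ('r, 'm, 'd) module_scheme \<Rightarrow> ('r, 'n, 'e) module_scheme \<Rightarrow> ('m \<times> 'n \<Rightarrow> 'r) set"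
  where "tensor_null R M N =
    gen_submodule R (free_module R (carrier M \<times> carrier N)) (tensor_rels R M N)"

definition tensor ::
  "('r, 'c) ring_scheme \<Rightarrow> ('r, 'm, 'd) module_scheme \<Rightarrow> ('r, 'n, 'e) module_scheme \<Rightarrow>
   ('r, ('m \<times> 'n \<Rightarrow> 'r) set) module"
  where "tensor R M N =
    quot_module (free_module R (carrier M \<times> carrier N)) (tensor_null R M N)"

text \<open>The pure tensor of \<open>x\<close> and \<open>y\<close>.\<close>

definition tens ::
  "('r, 'c) ring_scheme \<Rightarrow> ('r, 'm, 'd) module_scheme \<Rightarrow> ('r, 'n, 'e) module_scheme \<Rightarrow>
   'm \<Rightarrow> 'n \<Rightarrow> ('m \<times> 'n \<Rightarrow> 'r) set"
  where "tens R M N x y =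
    tensor_null R M N +>\<^bsub>free_module R (carrier M \<times> carrier N)\<^esub> free_gen R (x, y)"

text \<open>
  For a bilinear map \<open>b\<close>, \<open>tensor_lift R M N P b\<close> is the linear map out of the tensor product that
  it induces (see \<open>tensor_lift_lin\<close>, \<open>tensor_lift_tens\<close> and \<open>tensor_lin_eqI\<close> below). Hence
  \<open>tensor_lift R M N P b t\<close> is the Sweedler-style sum of the \<open>b t\<^sub>1 t\<^sub>2\<close>, where
  \<open>t\<close> is the sum of the pure tensors of \<open>t\<^sub>1\<close> and \<open>t\<^sub>2\<close>.
\<close>

definition free_eval ::
  "('r, 'c) ring_scheme \<Rightarrow> ('r, 'p, 'f) module_scheme \<Rightarrow> ('s \<Rightarrow> 'p) \<Rightarrow> ('s \<Rightarrow> 'r) \<Rightarrow> 'p"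
  where "free_eval R P h f = (\<Oplus>\<^bsub>P\<^esub>s\<in>{s. f s \<noteq> \<zero>\<^bsub>R\<^esub>}. f s \<odot>\<^bsub>P\<^esub> h s)"

definition tensor_lift ::
  "('r, 'c) ring_scheme \<Rightarrow> ('r, 'm, 'd) module_scheme \<Rightarrow> ('r, 'n, 'e) module_scheme \<Rightarrow>
   ('r, 'p, 'f) module_scheme \<Rightarrow> ('m \<Rightarrow> 'n \<Rightarrow> 'p) \<Rightarrow> ('m \<times> 'n \<Rightarrow> 'r) set \<Rightarrow> 'p"
  where "tensor_lift R M N P b t = the_elem (free_eval R P (\<lambda>(x, y). b x y) ` t)"

definition tensor_map ::
  "('r, 'c) ring_scheme \<Rightarrow> ('r, 'm, 'd) module_scheme \<Rightarrow> ('r, 'n, 'e) module_scheme \<Rightarrow>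
   ('r, 'p, 'f) module_scheme \<Rightarrow> ('r, 'q, 'g) module_scheme \<Rightarrow> ('m \<Rightarrow> 'p) \<Rightarrow> ('n \<Rightarrow> 'q) \<Rightarrow>
   ('m \<times> 'n \<Rightarrow> 'r) set \<Rightarrow> ('p \<times> 'q \<Rightarrow> 'r) set"
  where "tensor_map R M N P Q f g =
    tensor_lift R M N (tensor R P Q) (\<lambda>x y. tens R P Q (f x) (g y))"

text \<open>
  Threefold tensor products are bracketed to the right; \<open>assoc_r\<close> and \<open>assoc_l\<close> are the canonical
  isomorphisms that are usually suppressed in writing.
\<close>

definition assoc_r ::
  "('r, 'c) ring_scheme \<Rightarrow> ('r, 'm, 'd) module_scheme \<Rightarrow> ('r, 'n, 'e) module_scheme \<Rightarrow>
   ('r, 'p, 'f) module_scheme \<Rightarrow>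
   (('m \<times> 'n \<Rightarrow> 'r) set \<times> 'p \<Rightarrow> 'r) set \<Rightarrow> ('m \<times> ('n \<times> 'p \<Rightarrow> 'r) set \<Rightarrow> 'r) set"
  where "assoc_r R M N P =
    tensor_lift R (tensor R M N) P (tensor R M (tensor R N P))
      (\<lambda>u z. tensor_lift R M N (tensor R M (tensor R N P))
        (\<lambda>x y. tens R M (tensor R N P) x (tens R N P y z)) u)"

definition assoc_l ::
  "('r, 'c) ring_scheme \<Rightarrow> ('r, 'm, 'd) module_scheme \<Rightarrow> ('r, 'n, 'e) module_scheme \<Rightarrow>
   ('r, 'p, 'f) module_scheme \<Rightarrow>
   ('m \<times> ('n \<times> 'p \<Rightarrow> 'r) set \<Rightarrow> 'r) set \<Rightarrow> (('m \<times> 'n \<Rightarrow> 'r) set \<times> 'p \<Rightarrow> 'r) set"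
  where "assoc_l R M N P =
    tensor_lift R M (tensor R N P) (tensor R (tensor R M N) P)
      (\<lambda>x u. tensor_lift R N P (tensor R (tensor R M N) P)
        (\<lambda>y z. tens R (tensor R M N) P (tens R M N x y) z) u)"

section \<open>The universal property of the tensor product\<close>

lemma lin_mapsI:
  assumes "\<And>x. x \<in> carrier M \<Longrightarrow> f x \<in> carrier N"
    and "\<And>x y. x \<in> carrier M \<Longrightarrow> y \<in> carrier M \<Longrightarrow> f (x \<oplus>\<^bsub>M\<^esub> y) = f x \<oplus>\<^bsub>N\<^esub> f y"
    and "\<And>r x. r \<in> carrier R \<Longrightarrow> x \<in> carrier M \<Longrightarrow> f (r \<odot>\<^bsub>M\<^esub> x) = r \<odot>\<^bsub>N\<^esub> f x"
  shows "f \<in> lin_maps R M N"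
  using assms by (auto simp: lin_maps_def)

lemma lin_mapsD:
  assumes "f \<in> lin_maps R M N"
  shows "\<And>x. x \<in> carrier M \<Longrightarrow> f x \<in> carrier N"
    and "\<And>x y. x \<in> carrier M \<Longrightarrow> y \<in> carrier M \<Longrightarrow> f (x \<oplus>\<^bsub>M\<^esub> y) = f x \<oplus>\<^bsub>N\<^esub> f y"
    and "\<And>r x. r \<in> carrier R \<Longrightarrow> x \<in> carrier M \<Longrightarrow> f (r \<odot>\<^bsub>M\<^esub> x) = r \<odot>\<^bsub>N\<^esub> f x"
  using assms by (auto simp: lin_maps_def)

lemma lin_maps_zero:
  assumes "module R M" "module R N" "f \<in> lin_maps R M N"
  shows "f \<zero>\<^bsub>M\<^esub> = \<zero>\<^bsub>N\<^esub>"
proof -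
  interpret M: module R M by fact
  interpret N: module R N by fact
  have "f \<zero>\<^bsub>M\<^esub> = f (\<zero>\<^bsub>R\<^esub> \<odot>\<^bsub>M\<^esub> \<zero>\<^bsub>M\<^esub>)" by simp
  also have "\<dots> = \<zero>\<^bsub>R\<^esub> \<odot>\<^bsub>N\<^esub> f \<zero>\<^bsub>M\<^esub>"
    using lin_mapsD(3)[OF assms(3), of "\<zero>\<^bsub>R\<^esub>" "\<zero>\<^bsub>M\<^esub>"] by simp
  also have "\<dots> = \<zero>\<^bsub>N\<^esub>" using lin_mapsD(1)[OF assms(3)] by simp
  finally show ?thesis .
qed

lemma lin_maps_minus:
  assumes "module R M" "module R N" "f \<in> lin_maps R M N" "x \<in> carrier M" "y \<in> carrier M"
  shows "f (x \<ominus>\<^bsub>M\<^esub> y) = f x \<ominus>\<^bsub>N\<^esub> f y"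
proof -
  interpret M: module R M by fact
  interpret N: module R N by fact
  have "f x = f ((x \<ominus>\<^bsub>M\<^esub> y) \<oplus>\<^bsub>M\<^esub> y)"
    using assms(4,5) by (simp add: M.minus_eq M.M.add.m_assoc M.M.l_neg)
  also have "\<dots> = f (x \<ominus>\<^bsub>M\<^esub> y) \<oplus>\<^bsub>N\<^esub> f y"
    using lin_mapsD(2)[OF assms(3), of "x \<ominus>\<^bsub>M\<^esub> y" y] assms(4,5) by simp
  finally show ?thesis
    using assms(4,5) lin_mapsD(1)[OF assms(3)]
    by (simp add: N.minus_eq N.M.add.m_assoc N.M.r_neg)
qed

lemma ring_as_module_module:
  assumes "cring R"
  shows "module R (ring_as_module R)"
proof -
  interpret cring R by fact
  have "abelian_group (ring_as_module R)"
  proof (rule abelian_groupI)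
    fix x assume "x \<in> carrier (ring_as_module R)"
    then show "\<exists>y\<in>carrier (ring_as_module R). y \<oplus>\<^bsub>ring_as_module R\<^esub> x = \<zero>\<^bsub>ring_as_module R\<^esub>"
      by (intro bexI[of _ "\<ominus>\<^bsub>R\<^esub> x"]) (auto simp: ring_as_module_def l_neg)
  qed (auto simp: ring_as_module_def a_ac)
  then show ?thesis
    by (intro moduleI) (auto simp: ring_as_module_def l_distr r_distr m_assoc cring_axioms)
qed

lemma free_module_module:
  fixes R :: "('r, 'c) ring_scheme" and S :: "'s set"
  assumes "cring R"
  shows "module R (free_module R S)"
proof -
  interpret cring R by fact
  have fin: "finite {s. f s \<oplus>\<^bsub>R\<^esub> g s \<noteq> \<zero>\<^bsub>R\<^esub>}"
    if "finite {s. f s \<noteq> \<zero>\<^bsub>R\<^esub>}" "finite {s. g s \<noteq> \<zero>\<^bsub>R\<^esub>}" for f g :: "'s \<Rightarrow> 'r"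
    by (rule finite_subset[OF _ finite_UnI[OF that]]) auto
  have fin2: "finite {s. r \<otimes>\<^bsub>R\<^esub> f s \<noteq> \<zero>\<^bsub>R\<^esub>}"
    if "finite {s. f s \<noteq> \<zero>\<^bsub>R\<^esub>}" "r \<in> carrier R" for r and f :: "'s \<Rightarrow> 'r"
    using that by (auto elim!: finite_subset[rotated])
  have "abelian_group (free_module R S)"
  proof (rule abelian_groupI)
    fix f assume f: "f \<in> carrier (free_module R S)"
    have "{s. \<ominus>\<^bsub>R\<^esub> f s \<noteq> \<zero>\<^bsub>R\<^esub>} \<subseteq> {s. f s \<noteq> \<zero>\<^bsub>R\<^esub>}" by auto
    with f have "(\<lambda>s. \<ominus>\<^bsub>R\<^esub> f s) \<in> carrier (free_module R S)"
      by (auto simp: free_module_def intro: finite_subset)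
    moreover have "(\<lambda>s. \<ominus>\<^bsub>R\<^esub> f s) \<oplus>\<^bsub>free_module R S\<^esub> f = \<zero>\<^bsub>free_module R S\<^esub>"
      using f by (auto simp: free_module_def l_neg)
    ultimately show "\<exists>g\<in>carrier (free_module R S). g \<oplus>\<^bsub>free_module R S\<^esub> f = \<zero>\<^bsub>free_module R S\<^esub>"
      by blast
  qed (auto simp: free_module_def a_ac fin)
  then show ?thesis
    by (intro moduleI) (auto simp: free_module_def l_distr r_distr m_assoc cring_axioms fin2)
qed

lemma gen_submodule_submodule:
  assumes "module R M" "X \<subseteq> carrier M"
  shows "submodule (gen_submodule R M X) R M"
proof -
  interpret module R M by fact
  show ?thesis
  proof (rule submoduleI)
    show "gen_submodule R M X \<subseteq> carrier M"
      using carrier_is_submodule assms(2) unfolding gen_submodule_def by auto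
    have "\<zero>\<^bsub>M\<^esub> \<in> H" if "submodule H R M" for H
      using subgroup.one_closed[OF submodule.axioms(1)[OF that]] by simp
    then show "\<zero>\<^bsub>M\<^esub> \<in> gen_submodule R M X"
      by (simp add: gen_submodule_def)
  qed (simp_all add: gen_submodule_def submoduleE(3-5))
qed

lemma gen_submodule_superset: "X \<subseteq> gen_submodule R M X"
  by (auto simp: gen_submodule_def)

lemma submodule_abelian_subgroup:
  assumes "module R M" "submodule H R M"
  shows "abelian_subgroup H M"
proof -
  interpret module R M by fact
  show ?thesis
    by (rule abelian_subgroupI3[OF additive_subgroup.intro[OF submodule.axioms(1)[OF assms(2)]]])
      (rule M.abelian_group_axioms)
qed

lemma quot_module_smult:
  assumes "module R M" "submodule H R M" "r \<in> carrier R" "x \<in> carrier M"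
  shows "r \<odot>\<^bsub>quot_module M H\<^esub> (H +>\<^bsub>M\<^esub> x) = H +>\<^bsub>M\<^esub> (r \<odot>\<^bsub>M\<^esub> x)"
proof -
  interpret module R M by fact
  interpret H: abelian_subgroup H M by (rule submodule_abelian_subgroup) fact+
  note HE = submoduleE[OF assms(2)]
  have "H +>\<^bsub>M\<^esub> (r \<odot>\<^bsub>M\<^esub> y) = H +>\<^bsub>M\<^esub> (r \<odot>\<^bsub>M\<^esub> x)" if "y \<in> H +>\<^bsub>M\<^esub> x" for y
  proof -
    from that obtain h where h: "h \<in> H" "y = h \<oplus>\<^bsub>M\<^esub> x"
      by (auto simp: a_r_coset_def')
    then have "r \<odot>\<^bsub>M\<^esub> y = r \<odot>\<^bsub>M\<^esub> h \<oplus>\<^bsub>M\<^esub> r \<odot>\<^bsub>M\<^esub> x"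
      using assms(3,4) HE(1) by (auto simp: smult_r_distr)
    then have "r \<odot>\<^bsub>M\<^esub> y \<in> H +>\<^bsub>M\<^esub> (r \<odot>\<^bsub>M\<^esub> x)"
      using HE(4)[OF assms(3) h(1)] by (auto simp: a_r_coset_def')
    then show ?thesis
      using H.a_repr_independence'[of "r \<odot>\<^bsub>M\<^esub> y" "r \<odot>\<^bsub>M\<^esub> x"] assms(3,4) by (metis smult_closed)
  qed
  moreover have "x \<in> H +>\<^bsub>M\<^esub> x" using H.a_rcos_self assms(4) by simp
  ultimately have "(\<Union>y\<in>H +>\<^bsub>M\<^esub> x. H +>\<^bsub>M\<^esub> (r \<odot>\<^bsub>M\<^esub> y)) = H +>\<^bsub>M\<^esub> (r \<odot>\<^bsub>M\<^esub> x)"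
    by blast
  then show ?thesis by (simp add: quot_module_def)
qed

lemma quot_module_simps:
  "carrier (quot_module M H) = (\<lambda>x. H +>\<^bsub>M\<^esub> x) ` carrier M"
  "add (quot_module M H) = set_add M"
  "zero (quot_module M H) = H"
  by (auto simp: quot_module_def A_RCOSETS_def')

lemma quot_module_module:
  assumes "module R M" "submodule H R M"
  shows "module R (quot_module M H)"
proof -
  interpret module R M by fact
  interpret H: abelian_subgroup H M by (rule submodule_abelian_subgroup) fact+
  let ?Q = "quot_module M H"
  have sum: "(H +>\<^bsub>M\<^esub> x) \<oplus>\<^bsub>?Q\<^esub> (H +>\<^bsub>M\<^esub> y) = H +>\<^bsub>M\<^esub> (x \<oplus>\<^bsub>M\<^esub> y)"
    if "x \<in> carrier M" "y \<in> carrier M" for x y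
    using H.a_rcos_sum that by (simp add: quot_module_simps)
  have zero: "\<zero>\<^bsub>?Q\<^esub> = H +>\<^bsub>M\<^esub> \<zero>\<^bsub>M\<^esub>"
    using submoduleE(1)[OF assms(2)] by (simp add: quot_module_simps)
  note smult = quot_module_smult[OF assms]
  have "abelian_group ?Q"
  proof (rule abelian_groupI)
    fix X assume "X \<in> carrier ?Q"
    then obtain x where x: "x \<in> carrier M" "X = H +>\<^bsub>M\<^esub> x" by (auto simp: quot_module_simps(1))
    then have "(H +>\<^bsub>M\<^esub> (\<ominus>\<^bsub>M\<^esub> x)) \<oplus>\<^bsub>?Q\<^esub> X = \<zero>\<^bsub>?Q\<^esub>"
      by (simp add: sum zero M.l_neg)
    with x show "\<exists>Y\<in>carrier ?Q. Y \<oplus>\<^bsub>?Q\<^esub> X = \<zero>\<^bsub>?Q\<^esub>"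
      by (intro bexI[of _ "H +>\<^bsub>M\<^esub> (\<ominus>\<^bsub>M\<^esub> x)"]) (auto simp: quot_module_simps(1))
  qed (auto simp: quot_module_simps(1) sum zero M.a_ac)
  then show ?thesis
    by (intro moduleI)
      (auto simp: quot_module_simps(1) sum smult smult_l_distr smult_r_distr smult_assoc1
        R.cring_axioms)
qed

lemma free_gen_carrier:
  assumes "cring R" "s \<in> S"
  shows "free_gen R s \<in> carrier (free_module R S)"
proof -
  interpret cring R by fact
  have "{t. free_gen R s t \<noteq> \<zero>\<^bsub>R\<^esub>} \<subseteq> {s}" by (auto simp: free_gen_def)
  with assms show ?thesis
    by (auto simp: free_module_def free_gen_def intro: finite_subset)
qed

lemma tensor_rels_subset:
  assumes "module R M" "module R N"
  shows "tensor_rels R M N \<subseteq> carrier (free_module R (carrier M \<times> carrier N))"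
proof -
  interpret M: module R M by fact
  interpret N: module R N by fact
  interpret F: module R "free_module R (carrier M \<times> carrier N)"
    by (rule free_module_module) (rule M.R.cring_axioms)
  show ?thesis
    unfolding tensor_rels_def Let_def
    by (auto intro!: F.M.minus_closed F.M.a_closed F.smult_closed free_gen_carrier M.R.cring_axioms)
qed

lemma tensor_null_submodule:
  assumes "module R M" "module R N"
  shows "submodule (tensor_null R M N) R (free_module R (carrier M \<times> carrier N))"
  unfolding tensor_null_def using assms
  by (intro gen_submodule_submodule free_module_module tensor_rels_subset) (auto simp: module_def)

lemma tensor_module:
  assumes "module R M" "module R N"
  shows "module R (tensor R M N)"
  unfolding tensor_def using assms
  by (intro quot_module_module tensor_null_submodule free_module_module) (auto simp: module_def)

lemma quot_module_eqI:
  assumes "module R M" "submodule H R M" "x \<in> carrier M" "y \<in> carrier M" "x \<ominus>\<^bsub>M\<^esub> y \<in> H"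
  shows "H +>\<^bsub>M\<^esub> x = H +>\<^bsub>M\<^esub> y"
proof -
  interpret module R M by fact
  interpret H: abelian_subgroup H M by (rule submodule_abelian_subgroup) fact+
  have "x \<in> H +>\<^bsub>M\<^esub> y"
    using H.a_rcos_module_rev[of y x] assms(3-5) by (simp add: a_minus_def)
  then show ?thesis using H.a_repr_independence'[of x y] assms(4) by simp
qed

lemma quot_module_proj:
  assumes "module R M" "submodule H R M"
  shows "(\<lambda>x. H +>\<^bsub>M\<^esub> x) \<in> lin_maps R M (quot_module M H)"
proof -
  interpret module R M by fact
  interpret H: abelian_subgroup H M by (rule submodule_abelian_subgroup) fact+
  show ?thesis
    using quot_module_smult[OF assms]
    by (intro lin_mapsI) (auto simp: quot_module_simps H.a_rcos_sum)
qed

lemma tens_bilinear: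
  assumes "module R M" "module R N"
  shows "bilinear_map R M N (tensor R M N) (tens R M N)"
proof -
  interpret M: module R M by fact
  interpret N: module R N by fact
  let ?S = "carrier M \<times> carrier N"
  let ?F = "free_module R ?S"
  let ?K = "tensor_null R M N"
  have F: "module R ?F" by (rule free_module_module) (rule M.R.cring_axioms)
  interpret F: module R ?F by fact
  note K = tensor_null_submodule[OF assms]
  note proj = quot_module_proj[OF F K, folded tensor_def]
  have g: "free_gen R (x, y) \<in> carrier ?F" if "x \<in> carrier M" "y \<in> carrier N" for x y
    using that by (intro free_gen_carrier M.R.cring_axioms) auto
  have rels: "f \<in> ?K" if "f \<in> tensor_rels R M N" for f
    unfolding tensor_null_def by (rule subsetD[OF gen_submodule_superset that])
  have rel1: "free_gen R (x \<oplus>\<^bsub>M\<^esub> x', y) \<ominus>\<^bsub>?F\<^esub> (free_gen R (x, y) \<oplus>\<^bsub>?F\<^esub> free_gen R (x', y)) \<in> ?K"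
    if "x \<in> carrier M" "x' \<in> carrier M" "y \<in> carrier N" for x x' y
    by (rule rels, unfold tensor_rels_def Let_def) (use that in blast)
  have rel2: "free_gen R (x, y \<oplus>\<^bsub>N\<^esub> y') \<ominus>\<^bsub>?F\<^esub> (free_gen R (x, y) \<oplus>\<^bsub>?F\<^esub> free_gen R (x, y')) \<in> ?K"
    if "x \<in> carrier M" "y \<in> carrier N" "y' \<in> carrier N" for x y y'
    by (rule rels, unfold tensor_rels_def Let_def) (use that in blast)
  have rel3: "free_gen R (r \<odot>\<^bsub>M\<^esub> x, y) \<ominus>\<^bsub>?F\<^esub> (r \<odot>\<^bsub>?F\<^esub> free_gen R (x, y)) \<in> ?K"
    if "r \<in> carrier R" "x \<in> carrier M" "y \<in> carrier N" for r x y
    by (rule rels, unfold tensor_rels_def Let_def) (use that in blast)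
  have rel4: "free_gen R (x, r \<odot>\<^bsub>N\<^esub> y) \<ominus>\<^bsub>?F\<^esub> (r \<odot>\<^bsub>?F\<^esub> free_gen R (x, y)) \<in> ?K"
    if "r \<in> carrier R" "x \<in> carrier M" "y \<in> carrier N" for r x y
    by (rule rels, unfold tensor_rels_def Let_def) (use that in blast)
  show ?thesis
    unfolding bilinear_map_def
  proof (intro conjI ballI; rule lin_mapsI)
    fix x y assume "x \<in> carrier M" "y \<in> carrier N"
    then show "tens R M N x y \<in> carrier (tensor R M N)"
      unfolding tens_def by (intro lin_mapsD(1)[OF proj] g)
    then show "tens R M N x y \<in> carrier (tensor R M N)" .
  next
    fix x y z assume xyz: "x \<in> carrier M" "y \<in> carrier N" "z \<in> carrier N"
    have "tens R M N x (y \<oplus>\<^bsub>N\<^esub> z) = ?K +>\<^bsub>?F\<^esub> (free_gen R (x, y) \<oplus>\<^bsub>?F\<^esub> free_gen R (x, z))"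
      unfolding tens_def
      by (rule quot_module_eqI[OF F K])
        (use xyz in \<open>simp_all add: g rel1 rel2 rel3 rel4\<close>)
    then show "tens R M N x (y \<oplus>\<^bsub>N\<^esub> z) = tens R M N x y \<oplus>\<^bsub>tensor R M N\<^esub> tens R M N x z"
      unfolding tens_def lin_mapsD(2)[OF proj g[OF xyz(1,2)] g[OF xyz(1,3)]] .
  next
    fix x y z assume xyz: "z \<in> carrier N" "x \<in> carrier M" "y \<in> carrier M"
    have "tens R M N (x \<oplus>\<^bsub>M\<^esub> y) z = ?K +>\<^bsub>?F\<^esub> (free_gen R (x, z) \<oplus>\<^bsub>?F\<^esub> free_gen R (y, z))"
      unfolding tens_def
      by (rule quot_module_eqI[OF F K])
        (use xyz in \<open>simp_all add: g rel1 rel2 rel3 rel4\<close>)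
    then show "tens R M N (x \<oplus>\<^bsub>M\<^esub> y) z = tens R M N x z \<oplus>\<^bsub>tensor R M N\<^esub> tens R M N y z"
      unfolding tens_def lin_mapsD(2)[OF proj g[OF xyz(2,1)] g[OF xyz(3,1)]] .
  next
    fix x r y assume xyz: "x \<in> carrier M" "r \<in> carrier R" "y \<in> carrier N"
    have "tens R M N x (r \<odot>\<^bsub>N\<^esub> y) = ?K +>\<^bsub>?F\<^esub> (r \<odot>\<^bsub>?F\<^esub> free_gen R (x, y))"
      unfolding tens_def
      by (rule quot_module_eqI[OF F K])
        (use xyz in \<open>simp_all add: g rel1 rel2 rel3 rel4\<close>)
    then show "tens R M N x (r \<odot>\<^bsub>N\<^esub> y) = r \<odot>\<^bsub>tensor R M N\<^esub> tens R M N x y"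
      unfolding tens_def lin_mapsD(3)[OF proj xyz(2) g[OF xyz(1,3)]] .
  next
    fix y r x assume xyz: "y \<in> carrier N" "r \<in> carrier R" "x \<in> carrier M"
    have "tens R M N (r \<odot>\<^bsub>M\<^esub> x) y = ?K +>\<^bsub>?F\<^esub> (r \<odot>\<^bsub>?F\<^esub> free_gen R (x, y))"
      unfolding tens_def
      by (rule quot_module_eqI[OF F K])
        (use xyz in \<open>simp_all add: g rel1 rel2 rel3 rel4\<close>)
    then show "tens R M N (r \<odot>\<^bsub>M\<^esub> x) y = r \<odot>\<^bsub>tensor R M N\<^esub> tens R M N x y"
      unfolding tens_def lin_mapsD(3)[OF proj xyz(2) g[OF xyz(3,1)]] .
  qed
qed

lemma free_eval_eq:
  assumes "module R P" "h \<in> S \<rightarrow> carrier P" "f \<in> carrier (free_module R S)"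
    "finite T" "T \<subseteq> S" "{s. f s \<noteq> \<zero>\<^bsub>R\<^esub>} \<subseteq> T"
  shows "free_eval R P h f = (\<Oplus>\<^bsub>P\<^esub>s\<in>T. f s \<odot>\<^bsub>P\<^esub> h s)"
proof -
  interpret module R P by fact
  have "(\<Oplus>\<^bsub>P\<^esub>s\<in>T. f s \<odot>\<^bsub>P\<^esub> h s) = (\<Oplus>\<^bsub>P\<^esub>s\<in>{s. f s \<noteq> \<zero>\<^bsub>R\<^esub>}. f s \<odot>\<^bsub>P\<^esub> h s)"
  proof (rule M.add.finprod_mono_neutral_cong_right)
    show "finite T" "{s. f s \<noteq> \<zero>\<^bsub>R\<^esub>} \<subseteq> T" by fact+
  qed (use assms in \<open>auto simp: free_module_def Pi_iff subset_eq\<close>)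
  then show ?thesis by (simp add: free_eval_def)
qed

lemma free_eval_lin:
  fixes R :: "('r, 'c) ring_scheme" and S :: "'s set"
  assumes "module R P" "h \<in> S \<rightarrow> carrier P"
  shows "free_eval R P h \<in> lin_maps R (free_module R S) P"
proof -
  interpret module R P by fact
  interpret F: module R "free_module R S"
    by (rule free_module_module) (rule R.cring_axioms)
  let ?supp = "\<lambda>f. {s. f s \<noteq> \<zero>\<^bsub>R\<^esub>}"
  have supp: "?supp f \<subseteq> S" "finite (?supp f)" "\<And>s. f s \<in> carrier R"
    if "f \<in> carrier (free_module R S)" for f :: "'s \<Rightarrow> 'r"
    using that by (auto simp: free_module_def)
  have hs: "\<And>s. s \<in> S \<Longrightarrow> h s \<in> carrier P" using assms(2) by auto
  show ?thesis
  proof (rule lin_mapsI)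
    fix f assume f: "f \<in> carrier (free_module R S)"
    show "free_eval R P h f \<in> carrier P"
      unfolding free_eval_def using supp[OF f] hs by (intro M.finsum_closed) auto
    fix g assume g: "g \<in> carrier (free_module R S)"
    let ?T = "?supp f \<union> ?supp g"
    have T: "finite ?T" "?T \<subseteq> S" using supp[OF f] supp[OF g] by auto
    have fg: "(f \<oplus>\<^bsub>free_module R S\<^esub> g) s = f s \<oplus>\<^bsub>R\<^esub> g s" for s by (simp add: free_module_def)
    have "free_eval R P h (f \<oplus>\<^bsub>free_module R S\<^esub> g) =
        (\<Oplus>\<^bsub>P\<^esub>s\<in>?T. (f \<oplus>\<^bsub>free_module R S\<^esub> g) s \<odot>\<^bsub>P\<^esub> h s)"
      by (rule free_eval_eq[OF assms F.M.a_closed[OF f g] T]) (auto simp: fg)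
    also have "\<dots> = (\<Oplus>\<^bsub>P\<^esub>s\<in>?T. f s \<odot>\<^bsub>P\<^esub> h s \<oplus>\<^bsub>P\<^esub> g s \<odot>\<^bsub>P\<^esub> h s)"
      using T supp[OF f] supp[OF g] hs
      by (intro M.finsum_cong' refl) (auto simp: fg smult_l_distr subset_eq)
    also have "\<dots> = (\<Oplus>\<^bsub>P\<^esub>s\<in>?T. f s \<odot>\<^bsub>P\<^esub> h s) \<oplus>\<^bsub>P\<^esub> (\<Oplus>\<^bsub>P\<^esub>s\<in>?T. g s \<odot>\<^bsub>P\<^esub> h s)"
      using T supp[OF f] supp[OF g] hs by (intro M.finsum_addf) auto
    also have "\<dots> = free_eval R P h f \<oplus>\<^bsub>P\<^esub> free_eval R P h g"
      using free_eval_eq[OF assms f T] free_eval_eq[OF assms g T] by simp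
    finally show "free_eval R P h (f \<oplus>\<^bsub>free_module R S\<^esub> g) =
      free_eval R P h f \<oplus>\<^bsub>P\<^esub> free_eval R P h g" .
  next
    fix r f assume r: "r \<in> carrier R" and f: "f \<in> carrier (free_module R S)"
    note T = supp(2,1)[OF f]
    have rf: "(r \<odot>\<^bsub>free_module R S\<^esub> f) s = r \<otimes>\<^bsub>R\<^esub> f s" for s by (simp add: free_module_def)
    have "free_eval R P h (r \<odot>\<^bsub>free_module R S\<^esub> f) =
        (\<Oplus>\<^bsub>P\<^esub>s\<in>?supp f. (r \<odot>\<^bsub>free_module R S\<^esub> f) s \<odot>\<^bsub>P\<^esub> h s)"
      by (rule free_eval_eq[OF assms F.smult_closed[OF r f] T]) (use r in \<open>auto simp: rf\<close>)
    also have "\<dots> = (\<Oplus>\<^bsub>P\<^esub>s\<in>?supp f. r \<odot>\<^bsub>P\<^esub> (f s \<odot>\<^bsub>P\<^esub> h s))"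
      using supp[OF f] hs r
      by (intro M.finsum_cong' refl) (auto simp: rf smult_assoc1)
    also have "\<dots> = r \<odot>\<^bsub>P\<^esub> free_eval R P h f"
      unfolding free_eval_def using supp[OF f] hs r
      by (intro finsum_smult_ldistr[symmetric]) auto
    finally show "free_eval R P h (r \<odot>\<^bsub>free_module R S\<^esub> f) = r \<odot>\<^bsub>P\<^esub> free_eval R P h f" .
  qed
qed

lemma free_eval_gen:
  assumes "module R P" "h s \<in> carrier P"
  shows "free_eval R P h (free_gen R s) = h s"
proof -
  interpret module R P by fact
  have "free_eval R P h (free_gen R s) = (\<Oplus>\<^bsub>P\<^esub>t\<in>{s}. free_gen R s t \<odot>\<^bsub>P\<^esub> h t)"
    by (rule free_eval_eq[of _ _ _ "{s}"])
      (use assms free_gen_carrier[OF R.cring_axioms, of s "{s}"] in \<open>auto simp: free_gen_def\<close>)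
  then show ?thesis using assms by (simp add: free_gen_def)
qed

lemma submodule_ker:
  assumes "module R M" "module R P" "f \<in> lin_maps R M P"
  shows "submodule {x \<in> carrier M. f x = \<zero>\<^bsub>P\<^esub>} R M"
proof -
  interpret M: module R M by fact
  interpret P: module R P by fact
  note f = lin_mapsD[OF assms(3)]
  note z = lin_maps_zero[OF assms]
  show ?thesis
  proof (rule M.submoduleI)
    fix a assume a: "a \<in> {x \<in> carrier M. f x = \<zero>\<^bsub>P\<^esub>}"
    then have "f (\<zero>\<^bsub>M\<^esub> \<ominus>\<^bsub>M\<^esub> a) = \<zero>\<^bsub>P\<^esub>"
      using lin_maps_minus[OF assms, of "\<zero>\<^bsub>M\<^esub>" a] z by (simp add: P.minus_eq)
    with a show "\<ominus>\<^bsub>M\<^esub> a \<in> {x \<in> carrier M. f x = \<zero>\<^bsub>P\<^esub>}" by (simp add: M.minus_eq)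
  qed (simp_all add: z f)
qed

lemma tensor_lift_coset:
  assumes "module R M" "module R N" "module R P" "bilinear_map R M N P b"
    and "f \<in> carrier (free_module R (carrier M \<times> carrier N))"
  shows "tensor_lift R M N P b (tensor_null R M N +>\<^bsub>free_module R (carrier M \<times> carrier N)\<^esub> f) =
    free_eval R P (\<lambda>(x, y). b x y) f"
proof -
  interpret M: module R M by fact
  interpret N: module R N by fact
  interpret P: module R P by fact
  let ?F = "free_module R (carrier M \<times> carrier N)"
  let ?K = "tensor_null R M N"
  let ?e = "free_eval R P (\<lambda>(x, y). b x y)"
  have F: "module R ?F" by (rule free_module_module) (rule M.R.cring_axioms)
  interpret F: module R ?F by fact
  have b1: "(\<lambda>y. b x y) \<in> lin_maps R N P" if "x \<in> carrier M" for x
    using assms(4) that by (auto simp: bilinear_map_def)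
  have b2: "(\<lambda>x. b x y) \<in> lin_maps R M P" if "y \<in> carrier N" for y
    using assms(4) that by (auto simp: bilinear_map_def)
  have b: "b x y \<in> carrier P" if "x \<in> carrier M" "y \<in> carrier N" for x y
    using lin_mapsD(1)[OF b1] that by blast
  have e: "?e \<in> lin_maps R ?F P"
    by (rule free_eval_lin) (use assms b in auto)
  note e' = lin_mapsD[OF e] lin_maps_minus[OF F assms(3) e]
  have g: "free_gen R (x, y) \<in> carrier ?F" if "x \<in> carrier M" "y \<in> carrier N" for x y
    using that by (intro free_gen_carrier M.R.cring_axioms) auto
  have eg: "?e (free_gen R (x, y)) = b x y" if "x \<in> carrier M" "y \<in> carrier N" for x y
    using free_eval_gen[OF assms(3), of "\<lambda>(x, y). b x y" "(x, y)"] b that by simp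
  have z: "x \<ominus>\<^bsub>P\<^esub> x = \<zero>\<^bsub>P\<^esub>" if "x \<in> carrier P" for x
    using that by (simp add: P.minus_eq P.M.r_neg)
  have "tensor_rels R M N \<subseteq> {f \<in> carrier ?F. ?e f = \<zero>\<^bsub>P\<^esub>}"
    using tensor_rels_subset[OF assms(1,2)]
    by (auto simp: tensor_rels_def Let_def e' g eg b z
        lin_mapsD[OF b1] lin_mapsD[OF b2])
  then have "?K \<subseteq> {f \<in> carrier ?F. ?e f = \<zero>\<^bsub>P\<^esub>}"
    unfolding tensor_null_def gen_submodule_def
    by (intro Inter_lower CollectI conjI submodule_ker[OF F assms(3) e])
  then have K: "k \<in> carrier ?F \<and> ?e k = \<zero>\<^bsub>P\<^esub>" if "k \<in> ?K" for k using that by auto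
  interpret K: abelian_subgroup ?K ?F
    by (rule submodule_abelian_subgroup[OF F tensor_null_submodule[OF assms(1,2)]])
  have "?e g = ?e f" if "g \<in> ?K +>\<^bsub>?F\<^esub> f" for g
  proof -
    from that obtain k where k: "k \<in> ?K" "g = k \<oplus>\<^bsub>?F\<^esub> f" by (auto simp: a_r_coset_def')
    then show ?thesis using K[OF k(1)] assms(5) e'(1) by (simp add: e'(2))
  qed
  moreover have "f \<in> ?K +>\<^bsub>?F\<^esub> f" using K.a_rcos_self assms(5) by simp
  ultimately have "?e ` (?K +>\<^bsub>?F\<^esub> f) = {?e f}" by blast
  then show ?thesis by (simp add: tensor_lift_def)
qed

lemma tensor_lift_lin:
  assumes "module R M" "module R N" "module R P" "bilinear_map R M N P b"
  shows "tensor_lift R M N P b \<in> lin_maps R (tensor R M N) P"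
proof -
  interpret M: module R M by fact
  let ?F = "free_module R (carrier M \<times> carrier N)"
  let ?K = "tensor_null R M N"
  have F: "module R ?F" by (rule free_module_module) (rule M.R.cring_axioms)
  interpret F: module R ?F by fact
  note proj = lin_mapsD(2,3)[OF quot_module_proj[OF F tensor_null_submodule[OF assms(1,2)]], symmetric]
  have "(\<lambda>(x, y). b x y) \<in> carrier M \<times> carrier N \<rightarrow> carrier P"
    using assms(4) by (auto simp: bilinear_map_def lin_maps_def)
  note e = lin_mapsD[OF free_eval_lin[OF assms(3) this]]
  show ?thesis
    by (intro lin_mapsI)
      (auto simp: tensor_def quot_module_simps(1) proj tensor_lift_coset[OF assms] e)
qed

lemma tensor_lift_tens:
  assumes "module R M" "module R N" "module R P" "bilinear_map R M N P b"
    and "x \<in> carrier M" "y \<in> carrier N"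
  shows "tensor_lift R M N P b (tens R M N x y) = b x y"
proof -
  interpret M: module R M by fact
  have "b x y \<in> carrier P"
    using assms(4-6) by (auto simp: bilinear_map_def lin_maps_def)
  then show ?thesis
    using tensor_lift_coset[OF assms(1-4), of "free_gen R (x, y)"] assms(5,6)
      free_eval_gen[OF assms(3), of "\<lambda>(x, y). b x y" "(x, y)"]
    by (simp add: tens_def free_gen_carrier M.R.cring_axioms)
qed

lemma free_lin_eqI:
  fixes R :: "('r, 'c) ring_scheme" and S :: "'s set"
  assumes "cring R" "f \<in> lin_maps R (free_module R S) P" "g \<in> lin_maps R (free_module R S) P"
    and eq: "\<And>s. s \<in> S \<Longrightarrow> f (free_gen R s) = g (free_gen R s)"
    and "module R P" "p \<in> carrier (free_module R S)"
  shows "f p = g p"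
proof -
  interpret cring R by fact
  let ?F = "free_module R S"
  have F: "module R ?F" by (rule free_module_module) fact
  note f = lin_mapsD[OF assms(2)] and g = lin_mapsD[OF assms(3)]
  have "\<forall>p\<in>carrier ?F. {s. p s \<noteq> \<zero>\<^bsub>R\<^esub>} \<subseteq> T \<longrightarrow> f p = g p" if "finite T" "T \<subseteq> S" for T
    using that
  proof (induction T rule: finite_induct)
    case empty
    have "p = \<zero>\<^bsub>?F\<^esub>" if "{s. p s \<noteq> \<zero>\<^bsub>R\<^esub>} \<subseteq> {}" for p :: "'s \<Rightarrow> 'r"
      using that by (auto simp: free_module_def)
    then show ?case
      using lin_maps_zero[OF F assms(5,2)] lin_maps_zero[OF F assms(5,3)] by metis
  next
    case (insert s T)
    show ?case
    proof (intro ballI impI)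
      fix p assume p: "p \<in> carrier ?F" and sub: "{s. p s \<noteq> \<zero>\<^bsub>R\<^esub>} \<subseteq> insert s T"
      define q where "q = p(s := \<zero>\<^bsub>R\<^esub>)"
      have "{t. q t \<noteq> \<zero>\<^bsub>R\<^esub>} \<subseteq> {t. p t \<noteq> \<zero>\<^bsub>R\<^esub>}" by (auto simp: q_def)
      with p have q: "q \<in> carrier ?F"
        by (auto simp: free_module_def q_def intro: finite_subset)
      have sS: "s \<in> S" using insert.prems by simp
      have ps: "p s \<in> carrier R" using p by (simp add: free_module_def)
      have gen: "free_gen R s \<in> carrier ?F" by (rule free_gen_carrier) fact+
      have rgen: "p s \<odot>\<^bsub>?F\<^esub> free_gen R s \<in> carrier ?F"
        by (rule module.smult_closed[OF F ps gen])
      have pq: "p = q \<oplus>\<^bsub>?F\<^esub> p s \<odot>\<^bsub>?F\<^esub> free_gen R s"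
        using p by (auto simp: free_module_def q_def free_gen_def fun_eq_iff)
      have "{t. q t \<noteq> \<zero>\<^bsub>R\<^esub>} \<subseteq> T" using sub by (auto simp: q_def)
      then have "f q = g q" using insert q by blast
      then show "f p = g p"
        by (subst (1 2) pq) (simp add: f(2,3) g(2,3) q rgen gen ps eq sS)
    qed
  qed
  from this[of "{s. p s \<noteq> \<zero>\<^bsub>R\<^esub>}"] show ?thesis
    using assms(6) by (auto simp: free_module_def)
qed

lemma tensor_lin_eqI:
  assumes "module R M" "module R N" "module R P"
    and f: "f \<in> lin_maps R (tensor R M N) P" and g: "g \<in> lin_maps R (tensor R M N) P"
    and eq: "\<And>x y. x \<in> carrier M \<Longrightarrow> y \<in> carrier N \<Longrightarrow> f (tens R M N x y) = g (tens R M N x y)"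
    and t: "t \<in> carrier (tensor R M N)"
  shows "f t = g t"
proof -
  interpret M: module R M by fact
  let ?F = "free_module R (carrier M \<times> carrier N)"
  let ?p = "\<lambda>x. tensor_null R M N +>\<^bsub>?F\<^esub> x"
  have F: "module R ?F" by (rule free_module_module) (rule M.R.cring_axioms)
  have "?p \<in> lin_maps R ?F (tensor R M N)"
    unfolding tensor_def by (rule quot_module_proj[OF F tensor_null_submodule[OF assms(1,2)]])
  note p = lin_mapsD[OF this]
  have lin: "(\<lambda>x. h (?p x)) \<in> lin_maps R ?F P" if "h \<in> lin_maps R (tensor R M N) P" for h
    by (rule lin_mapsI) (simp_all add: p lin_mapsD[OF that])
  obtain x where x: "x \<in> carrier ?F" "t = ?p x"
    using t by (auto simp: tensor_def quot_module_simps(1))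
  have "f (?p x) = g (?p x)"
    by (rule free_lin_eqI[OF M.R.cring_axioms lin[OF f] lin[OF g] _ assms(3) x(1)])
      (use eq in \<open>auto simp: tens_def\<close>)
  with x show ?thesis by simp
qed

lemma tensor_lift_param:
  assumes "module R M" "module R N" "module R P" "module R X"
    and b: "\<And>x. x \<in> carrier X \<Longrightarrow> bilinear_map R M N P (b x)"
    and lin: "\<And>m n. m \<in> carrier M \<Longrightarrow> n \<in> carrier N \<Longrightarrow> (\<lambda>x. b x m n) \<in> lin_maps R X P"
    and t: "t \<in> carrier (tensor R M N)"
  shows "(\<lambda>x. tensor_lift R M N P (b x) t) \<in> lin_maps R X P"
proof -
  interpret P: module R P by fact
  interpret X: module R X by fact
  let ?l = "\<lambda>x. tensor_lift R M N P (b x)"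
  note l = tensor_lift_lin[OF assms(1-3) b]
  note lt = tensor_lift_tens[OF assms(1-3) b]
  show ?thesis
  proof (rule lin_mapsI)
    fix x assume x: "x \<in> carrier X"
    then show "?l x t \<in> carrier P" using lin_mapsD(1)[OF l t] by blast
    fix y assume y: "y \<in> carrier X"
    have "(\<lambda>t. ?l x t \<oplus>\<^bsub>P\<^esub> ?l y t) \<in> lin_maps R (tensor R M N) P"
      by (rule lin_mapsI)
        (simp_all add: lin_mapsD[OF l[OF x]] lin_mapsD[OF l[OF y]] P.smult_r_distr P.M.a_ac)
    then show "?l (x \<oplus>\<^bsub>X\<^esub> y) t = ?l x t \<oplus>\<^bsub>P\<^esub> ?l y t"
      by (rule tensor_lin_eqI[OF assms(1-3) l[OF X.M.a_closed[OF x y]]])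
        (simp_all add: lt x y t lin_mapsD(2)[OF lin])
  next
    fix r x assume r: "r \<in> carrier R" and x: "x \<in> carrier X"
    have "r \<odot>\<^bsub>P\<^esub> (s \<odot>\<^bsub>P\<^esub> p) = s \<odot>\<^bsub>P\<^esub> (r \<odot>\<^bsub>P\<^esub> p)" if "s \<in> carrier R" "p \<in> carrier P" for s p
      using that r by (simp add: P.smult_assoc1[symmetric] P.R.m_comm)
    then have "(\<lambda>t. r \<odot>\<^bsub>P\<^esub> ?l x t) \<in> lin_maps R (tensor R M N) P"
      by (intro lin_mapsI) (simp_all add: lin_mapsD[OF l[OF x]] P.smult_r_distr r)
    then show "?l (r \<odot>\<^bsub>X\<^esub> x) t = r \<odot>\<^bsub>P\<^esub> ?l x t"
      by (rule tensor_lin_eqI[OF assms(1-3) l[OF X.smult_closed[OF r x]]])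
        (simp_all add: lt r x t lin_mapsD(3)[OF lin])
  qed
qed

lemma bilinear_mapI:
  assumes "\<And>x. x \<in> carrier M \<Longrightarrow> (\<lambda>y. b x y) \<in> lin_maps R N P"
    and "\<And>y. y \<in> carrier N \<Longrightarrow> (\<lambda>x. b x y) \<in> lin_maps R M P"
  shows "bilinear_map R M N P b"
  using assms by (simp add: bilinear_map_def)

lemma bilinear_mapD:
  assumes "bilinear_map R M N P b"
  shows "x \<in> carrier M \<Longrightarrow> (\<lambda>y. b x y) \<in> lin_maps R N P"
    and "y \<in> carrier N \<Longrightarrow> (\<lambda>x. b x y) \<in> lin_maps R M P"
  using assms by (simp_all add: bilinear_map_def)

lemma lin_maps_comp:
  assumes "f \<in> lin_maps R M N" "g \<in> lin_maps R N P"
  shows "(\<lambda>x. g (f x)) \<in> lin_maps R M P"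
  by (rule lin_mapsI) (simp_all add: lin_mapsD[OF assms(1)] lin_mapsD[OF assms(2)])

lemma tensor_map_bilinear:
  assumes "module R P" "module R Q" "f \<in> lin_maps R M P" "g \<in> lin_maps R N Q"
  shows "bilinear_map R M N (tensor R P Q) (\<lambda>x y. tens R P Q (f x) (g y))"
proof -
  note b = bilinear_mapD[OF tens_bilinear[OF assms(1,2)]]
  show ?thesis
    by (rule bilinear_mapI)
      (rule lin_maps_comp[OF assms(4) b(1)] lin_maps_comp[OF assms(3) b(2)],
        erule lin_mapsD(1)[OF assms(3)] lin_mapsD(1)[OF assms(4)])+
qed

lemma tensor_map_lin:
  assumes "module R M" "module R N" "module R P" "module R Q"
    and "f \<in> lin_maps R M P" "g \<in> lin_maps R N Q"
  shows "tensor_map R M N P Q f g \<in> lin_maps R (tensor R M N) (tensor R P Q)"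
  unfolding tensor_map_def
  by (rule tensor_lift_lin[OF assms(1,2) tensor_module[OF assms(3,4)]
        tensor_map_bilinear[OF assms(3-6)]])

lemma tensor_map_tens:
  assumes "module R M" "module R N" "module R P" "module R Q"
    and "f \<in> lin_maps R M P" "g \<in> lin_maps R N Q" "x \<in> carrier M" "y \<in> carrier N"
  shows "tensor_map R M N P Q f g (tens R M N x y) = tens R P Q (f x) (g y)"
  unfolding tensor_map_def
  by (rule tensor_lift_tens[OF assms(1,2) tensor_module[OF assms(3,4)]
        tensor_map_bilinear[OF assms(3-6)] assms(7,8)])

lemma
  assumes M: "module R M" and N: "module R N" and P: "module R P"
  shows assoc_r_lin: "assoc_r R M N P \<in>
      lin_maps R (tensor R (tensor R M N) P) (tensor R M (tensor R N P))"
    and assoc_r_tens: "\<And>x y z. x \<in> carrier M \<Longrightarrow> y \<in> carrier N \<Longrightarrow> z \<in> carrier P \<Longrightarrow>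
      assoc_r R M N P (tens R (tensor R M N) P (tens R M N x y) z) =
      tens R M (tensor R N P) x (tens R N P y z)"
proof -
  let ?MN = "tensor R M N" and ?NP = "tensor R N P"
  let ?Q = "tensor R M ?NP"
  have MN: "module R ?MN" and NP: "module R ?NP" and Q: "module R ?Q"
    by (intro tensor_module assms)+
  note tNP = bilinear_mapD[OF tens_bilinear[OF N P]]
  note tQ = bilinear_mapD[OF tens_bilinear[OF M NP]]
  note tMN = bilinear_mapD[OF tens_bilinear[OF M N]]
  let ?b = "\<lambda>z x y. tens R M ?NP x (tens R N P y z)"
  have b: "bilinear_map R M N ?Q (?b z)" if "z \<in> carrier P" for z
    by (rule bilinear_mapI)
      (auto intro: that lin_maps_comp[OF tNP(2) tQ(1)] tQ(2) lin_mapsD(1)[OF tNP(1)])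
  have c: "(\<lambda>z. ?b z x y) \<in> lin_maps R P ?Q" if "x \<in> carrier M" "y \<in> carrier N" for x y
    using that by (intro lin_maps_comp[OF tNP(1) tQ(1)])
  have d: "bilinear_map R ?MN P ?Q (\<lambda>u z. tensor_lift R M N ?Q (?b z) u)"
    by (rule bilinear_mapI)
      (auto intro!: tensor_lift_param[OF M N Q P b c] tensor_lift_lin[OF M N Q b])
  show "assoc_r R M N P \<in> lin_maps R (tensor R ?MN P) ?Q"
    unfolding assoc_r_def by (rule tensor_lift_lin[OF MN P Q d])
  fix x y z assume xyz: "x \<in> carrier M" "y \<in> carrier N" "z \<in> carrier P"
  then show "assoc_r R M N P (tens R ?MN P (tens R M N x y) z) = ?b z x y"
    unfolding assoc_r_def
    by (simp add: tensor_lift_tens[OF MN P Q d] lin_mapsD(1)[OF tMN(1)]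
        tensor_lift_tens[OF M N Q b])
qed

lemma
  assumes M: "module R M" and N: "module R N" and P: "module R P"
  shows assoc_l_lin: "assoc_l R M N P \<in>
      lin_maps R (tensor R M (tensor R N P)) (tensor R (tensor R M N) P)"
    and assoc_l_tens: "\<And>x y z. x \<in> carrier M \<Longrightarrow> y \<in> carrier N \<Longrightarrow> z \<in> carrier P \<Longrightarrow>
      assoc_l R M N P (tens R M (tensor R N P) x (tens R N P y z)) =
      tens R (tensor R M N) P (tens R M N x y) z"
proof -
  let ?MN = "tensor R M N" and ?NP = "tensor R N P"
  let ?Q = "tensor R ?MN P"
  have MN: "module R ?MN" and NP: "module R ?NP" and Q: "module R ?Q"
    by (intro tensor_module assms)+
  note tNP = bilinear_mapD[OF tens_bilinear[OF N P]]
  note tQ = bilinear_mapD[OF tens_bilinear[OF MN P]]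
  note tMN = bilinear_mapD[OF tens_bilinear[OF M N]]
  let ?b = "\<lambda>x y z. tens R ?MN P (tens R M N x y) z"
  have b: "bilinear_map R N P ?Q (?b x)" if "x \<in> carrier M" for x
    by (rule bilinear_mapI)
      (auto intro: that lin_maps_comp[OF tMN(1) tQ(2)] tQ(1) lin_mapsD(1)[OF tMN(1)])
  have c: "(\<lambda>x. ?b x y z) \<in> lin_maps R M ?Q" if "y \<in> carrier N" "z \<in> carrier P" for y z
    using that by (intro lin_maps_comp[OF tMN(2) tQ(2)])
  have d: "bilinear_map R M ?NP ?Q (\<lambda>x u. tensor_lift R N P ?Q (?b x) u)"
    by (rule bilinear_mapI)
      (auto intro!: tensor_lift_param[OF N P Q M b c] tensor_lift_lin[OF N P Q b])
  show "assoc_l R M N P \<in> lin_maps R (tensor R M ?NP) ?Q"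
    unfolding assoc_l_def by (rule tensor_lift_lin[OF M NP Q d])
  fix x y z assume xyz: "x \<in> carrier M" "y \<in> carrier N" "z \<in> carrier P"
  then show "assoc_l R M N P (tens R M ?NP x (tens R N P y z)) = ?b x y z"
    unfolding assoc_l_def
    by (simp add: tensor_lift_tens[OF M NP Q d] lin_mapsD(1)[OF tNP(1)]
        tensor_lift_tens[OF N P Q b])
qed

section \<open>Hom-bialgebras, Hom-cobraiding forms, comodules\<close>

locale hom_bialgebra = cring_char_0 R + module R A
  for R :: "'r ring" and A :: "('r, 'a) module" +
  fixes mu :: "('a \<times> 'a \<Rightarrow> 'r) set \<Rightarrow> 'a"
    and Delta :: "'a \<Rightarrow> ('a \<times> 'a \<Rightarrow> 'r) set"
    and alpha :: "'a \<Rightarrow> 'a"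
  assumes mu_lin: "mu \<in> lin_maps R (tensor R A A) A"
    and Delta_lin: "Delta \<in> lin_maps R A (tensor R A A)"
    and alpha_lin: "alpha \<in> lin_maps R A A"
    and alpha_mu: "\<And>t. t \<in> carrier (tensor R A A) \<Longrightarrow>
      alpha (mu t) = mu (tensor_map R A A A A alpha alpha t)"
    and hom_assoc: "\<And>t. t \<in> carrier (tensor R A (tensor R A A)) \<Longrightarrow>
      mu (tensor_map R A (tensor R A A) A A alpha mu t) =
      mu (tensor_map R (tensor R A A) A A A mu alpha (assoc_l R A A A t))"
    and alpha_Delta: "\<And>x. x \<in> carrier A \<Longrightarrow>
      tensor_map R A A A A alpha alpha (Delta x) = Delta (alpha x)"
    and hom_coassoc: "\<And>x. x \<in> carrier A \<Longrightarrow>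
      tensor_map R A A A (tensor R A A) alpha Delta (Delta x) =
      assoc_r R A A A (tensor_map R A A (tensor R A A) A Delta alpha (Delta x))"
    and Delta_mu: "\<And>x y. x \<in> carrier A \<Longrightarrow> y \<in> carrier A \<Longrightarrow>
      Delta (mu (tens R A A x y)) =
      tensor_lift R A A (tensor R A A) (\<lambda>x1 x2.
        tensor_lift R A A (tensor R A A) (\<lambda>y1 y2.
          tens R A A (mu (tens R A A x1 y1)) (mu (tens R A A x2 y2))) (Delta y)) (Delta x)"

locale cobraided_hom_bialgebra = hom_bialgebra R A mu Delta alpha
  for R :: "'r ring" and A :: "('r, 'a) module" and mu Delta alpha +
  fixes cb :: "('a \<times> 'a \<Rightarrow> 'r) set \<Rightarrow> 'r"
  assumes cb_lin: "cb \<in> lin_maps R (tensor R A A) (ring_as_module R)"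
    and cb_mu_left: "\<And>x y z. x \<in> carrier A \<Longrightarrow> y \<in> carrier A \<Longrightarrow> z \<in> carrier A \<Longrightarrow>
      cb (tens R A A (mu (tens R A A x y)) (alpha z)) =
      tensor_lift R A A (ring_as_module R) (\<lambda>z1 z2.
        cb (tens R A A (alpha x) z1) \<otimes>\<^bsub>R\<^esub> cb (tens R A A (alpha y) z2)) (Delta z)"
    and cb_mu_right: "\<And>x y z. x \<in> carrier A \<Longrightarrow> y \<in> carrier A \<Longrightarrow> z \<in> carrier A \<Longrightarrow>
      cb (tens R A A (alpha x) (mu (tens R A A y z))) =
      tensor_lift R A A (ring_as_module R) (\<lambda>x1 x2.
        cb (tens R A A x1 (alpha z)) \<otimes>\<^bsub>R\<^esub> cb (tens R A A x2 (alpha y))) (Delta x)"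
    and cb_commute: "\<And>x y. x \<in> carrier A \<Longrightarrow> y \<in> carrier A \<Longrightarrow>
      tensor_lift R A A A (\<lambda>x1 x2.
        tensor_lift R A A A (\<lambda>y1 y2.
          cb (tens R A A x2 y2) \<odot>\<^bsub>A\<^esub> mu (tens R A A y1 x1)) (Delta y)) (Delta x) =
      tensor_lift R A A A (\<lambda>x1 x2.
        tensor_lift R A A A (\<lambda>y1 y2.
          cb (tens R A A x1 y1) \<odot>\<^bsub>A\<^esub> mu (tens R A A x2 y2)) (Delta y)) (Delta x)"

definition invariant_form ::
  "'r ring \<Rightarrow> ('r, 'a) module \<Rightarrow> ('a \<Rightarrow> 'a) \<Rightarrow> (('a \<times> 'a \<Rightarrow> 'r) set \<Rightarrow> 'r) \<Rightarrow> bool"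
  where "invariant_form R A alpha cb \<longleftrightarrow>
    (\<forall>t\<in>carrier (tensor R A A). cb t = cb (tensor_map R A A A A alpha alpha t))"

text \<open>
  A comodule only involves the underlying module, the comultiplication and the twisting map of
  the Hom-bialgebra.
\<close>

locale hom_comodule = A: module R A + M: module R M
  for R :: "'r ring" and A :: "('r, 'a) module"
    and Delta :: "'a \<Rightarrow> ('a \<times> 'a \<Rightarrow> 'r) set" and alpha :: "'a \<Rightarrow> 'a"
    and M :: "('r, 'm) module" +
  fixes alphaM :: "'m \<Rightarrow> 'm" and rho :: "'m \<Rightarrow> ('a \<times> 'm \<Rightarrow> 'r) set"
  assumes alphaM_lin: "alphaM \<in> lin_maps R M M"
    and rho_lin: "rho \<in> lin_maps R M (tensor R A M)"
    and rho_coassoc: "\<And>x. x \<in> carrier M \<Longrightarrow>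
      assoc_r R A A M (tensor_map R A M (tensor R A A) M Delta alphaM (rho x)) =
      tensor_map R A M A (tensor R A M) alpha rho (rho x)"
    and rho_alpha: "\<And>x. x \<in> carrier M \<Longrightarrow>
      tensor_map R A M A M alpha alphaM (rho x) = rho (alphaM x)"

section \<open>The Hom-Yang-Baxter equation\<close>

definition hybe_solution ::
  "'r ring \<Rightarrow> ('r, 'v) module \<Rightarrow> ('v \<Rightarrow> 'v) \<Rightarrow>
   (('v \<times> 'v \<Rightarrow> 'r) set \<Rightarrow> ('v \<times> 'v \<Rightarrow> 'r) set) \<Rightarrow> bool"
  where "hybe_solution R V alphaV B \<longleftrightarrow>
    (let VV = tensor R V V;
         aa = tensor_map R V V V V alphaV alphaV;
         aB = tensor_map R V VV V VV alphaV B;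
         Ba = assoc_r R V V V \<circ> tensor_map R VV V VV V B alphaV \<circ> assoc_l R V V V
     in B \<in> lin_maps R VV VV \<and>
        (\<forall>t\<in>carrier VV. (B \<circ> aa) t = (aa \<circ> B) t) \<and>
        (\<forall>t\<in>carrier (tensor R V VV). (aB \<circ> Ba \<circ> aB) t = (Ba \<circ> aB \<circ> Ba) t))"

definition braiding ::
  "'r ring \<Rightarrow> ('r, 'a) module \<Rightarrow> (('a \<times> 'a \<Rightarrow> 'r) set \<Rightarrow> 'r) \<Rightarrow> ('r, 'v) module \<Rightarrow>
   ('v \<Rightarrow> ('a \<times> 'v \<Rightarrow> 'r) set) \<Rightarrow> ('v \<times> 'v \<Rightarrow> 'r) set \<Rightarrow> ('v \<times> 'v \<Rightarrow> 'r) set"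
  where "braiding R A cb V rho = tensor_lift R V V (tensor R V V) (\<lambda>v w.
    tensor_lift R A V (tensor R V V) (\<lambda>vA vV.
      tensor_lift R A V (tensor R V V) (\<lambda>wA wV.
        cb (tens R A A wA vA) \<odot>\<^bsub>tensor R V V\<^esub> tens R V V wV vV) (rho w)) (rho v))"

text \<open>The formula for \<open>braiding\<close> is bilinear, so it does define a linear map.\<close>

lemma
  assumes A: "module R A" and V: "module R V"
    and cb: "cb \<in> lin_maps R (tensor R A A) (ring_as_module R)"
    and rho: "rho \<in> lin_maps R V (tensor R A V)"
  shows braiding_lin: "braiding R A cb V rho \<in> lin_maps R (tensor R V V) (tensor R V V)"
    and braiding_tens: "\<And>v w. v \<in> carrier V \<Longrightarrow> w \<in> carrier V \<Longrightarrow>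
      braiding R A cb V rho (tens R V V v w) =
      tensor_lift R A V (tensor R V V) (\<lambda>vA vV.
        tensor_lift R A V (tensor R V V) (\<lambda>wA wV.
          cb (tens R A A wA vA) \<odot>\<^bsub>tensor R V V\<^esub> tens R V V wV vV) (rho w)) (rho v)"
proof -
  let ?P = "tensor R V V" and ?AV = "tensor R A V"
  let ?R = "ring_as_module R"
  have P: "module R ?P" and AV: "module R ?AV" by (intro tensor_module assms)+
  interpret P: module R ?P by fact
  note tA = bilinear_mapD[OF tens_bilinear[OF A A]]
  note tV = bilinear_mapD[OF tens_bilinear[OF V V]]
  note cbD = lin_maps_comp[OF tA(1) cb] lin_maps_comp[OF tA(2) cb]
  have cR: "carrier ?R = carrier R" by (simp add: ring_as_module_def)
  have cbc: "cb (tens R A A a a') \<in> carrier R" if "a \<in> carrier A" "a' \<in> carrier A" for a a'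
    using lin_mapsD(1)[OF cbD(1)[OF that(1)] that(2)] cR by simp
  have tVc: "tens R V V v w \<in> carrier ?P" if "v \<in> carrier V" "w \<in> carrier V" for v w
    using lin_mapsD(1)[OF tV(1)[OF that(1)] that(2)] .
  let ?Q = "\<lambda>vA vV wA wV. cb (tens R A A wA vA) \<odot>\<^bsub>?P\<^esub> tens R V V wV vV"
  have sl: "(\<lambda>r. r \<odot>\<^bsub>?P\<^esub> p) \<in> lin_maps R ?R ?P" if "p \<in> carrier ?P" for p
    using that
    by (intro lin_mapsI) (auto simp: ring_as_module_def P.smult_l_distr P.smult_assoc1)
  have sr: "(\<lambda>p. r \<odot>\<^bsub>?P\<^esub> p) \<in> lin_maps R ?P ?P" if r: "r \<in> carrier R" for r
  proof (rule lin_mapsI)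
    fix s x assume "s \<in> carrier R" "x \<in> carrier ?P"
    then show "r \<odot>\<^bsub>?P\<^esub> (s \<odot>\<^bsub>?P\<^esub> x) = s \<odot>\<^bsub>?P\<^esub> (r \<odot>\<^bsub>?P\<^esub> x)"
      using r by (simp add: P.smult_assoc1[symmetric] P.R.m_comm)
  qed (use r in \<open>simp_all add: P.smult_r_distr\<close>)
  have Q1: "bilinear_map R A V ?P (?Q a v)" if "a \<in> carrier A" "v \<in> carrier V" for a v
    by (rule bilinear_mapI)
      (auto intro: that lin_maps_comp[OF cbD(2) sl] lin_maps_comp[OF tV(2) sr] cbc tVc)
  have Q2: "(\<lambda>a. ?Q a v a' v') \<in> lin_maps R A ?P"
    if "v \<in> carrier V" "a' \<in> carrier A" "v' \<in> carrier V" for v a' v'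
    using that by (intro lin_maps_comp[OF cbD(1) sl] tVc)
  have Q3: "(\<lambda>v. ?Q a v a' v') \<in> lin_maps R V ?P"
    if "a \<in> carrier A" "a' \<in> carrier A" "v' \<in> carrier V" for a a' v'
    using that by (intro lin_maps_comp[OF tV(1) sr] cbc)
  let ?L = "\<lambda>t a v. tensor_lift R A V ?P (?Q a v) t"
  have L: "bilinear_map R A V ?P (?L t)" if "t \<in> carrier ?AV" for t
    by (rule bilinear_mapI)
      (auto intro!: tensor_lift_param[OF A V P V] tensor_lift_param[OF A V P A] Q1 Q2 Q3 that)
  have Lt: "(\<lambda>t. ?L t a v) \<in> lin_maps R ?AV ?P" if "a \<in> carrier A" "v \<in> carrier V" for a v
    by (rule tensor_lift_lin[OF A V P Q1[OF that]])
  have K: "bilinear_map R ?AV ?AV ?P (\<lambda>s t. tensor_lift R A V ?P (?L t) s)"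
    by (rule bilinear_mapI)
      (auto intro!: tensor_lift_param[OF A V P AV L Lt] tensor_lift_lin[OF A V P L])
  have B: "bilinear_map R V V ?P (\<lambda>v w. tensor_lift R A V ?P (?L (rho w)) (rho v))"
    by (rule bilinear_mapI)
      (rule lin_maps_comp[OF rho bilinear_mapD(1)[OF K lin_mapsD(1)[OF rho]]]
         lin_maps_comp[OF rho bilinear_mapD(2)[OF K lin_mapsD(1)[OF rho]]], assumption)+
  show "braiding R A cb V rho \<in> lin_maps R ?P ?P"
    unfolding braiding_def by (rule tensor_lift_lin[OF V V P B])
  fix v w assume "v \<in> carrier V" "w \<in> carrier V"
  then show "braiding R A cb V rho (tens R V V v w) =
      tensor_lift R A V ?P (?L (rho w)) (rho v)"
    unfolding braiding_def by (rule tensor_lift_tens[OF V V P B])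
qed

end

theory Submission
  imports Defs
begin

text \<open>
  Write \<open>c(a, b)\<close> for the value of the cobraiding form on \<open>a \<otimes> b\<close> and \<open>\<alpha>\<close> for both twisting
  maps. For \<open>v\<close> in \<open>V\<close>, comodule coassociativity gives the element
  \<open>E(v) = (\<Delta> \<otimes> \<alpha>)(\<rho>(v)) = (\<alpha> \<otimes> \<rho>)(\<rho>(v))\<close> of \<open>(A \<otimes> A) \<otimes> V\<close> two expressions.

  Applying the left-hand side of the Hom-Yang-Baxter equation to \<open>u \<otimes> v \<otimes> w\<close> makes every
  vector coact twice, once in each of two of the three braidings. Because the form is
  \<open>\<alpha>\<close>-invariant, a missing \<open>\<alpha>\<close> can be inserted in the arguments of the form where it is needed,
  and the result then depends on \<open>u\<close>, \<open>v\<close>, \<open>w\<close> only through \<open>E\<close>, read off the second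
  expression. If \<open>E(w)\<close>, \<open>E(v)\<close>, \<open>E(u)\<close> are written as sums of \<open>(w\<^sub>1 \<otimes> w\<^sub>2) \<otimes> w'\<close>, and so on,
  the left-hand side is the sum of
    \<open>c(w\<^sub>1, v\<^sub>1) c(w\<^sub>2, u\<^sub>1) c(v\<^sub>2, u\<^sub>2) \<alpha>w' \<otimes> \<alpha>v' \<otimes> \<alpha>u'\<close>
  (lemma \<open>left_side\<close>). The right-hand side is in the same way the sum of
    \<open>c(w\<^sub>1, u\<^sub>2) c(w\<^sub>2, v\<^sub>2) c(v\<^sub>1, u\<^sub>1) \<alpha>w' \<otimes> \<alpha>v' \<otimes> \<alpha>u'\<close>
  (lemma \<open>right_side\<close>). With the first expression for \<open>E\<close>, the factors \<open>w\<^sub>1 \<otimes> w\<^sub>2\<close> become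
  \<open>\<Delta>(b)\<close> for the \<open>A\<close>-component \<open>b\<close> of \<open>\<rho>(w)\<close>, and the same for \<open>v\<close> and \<open>u\<close>, so it
  remains to prove an identity of scalars for \<open>a\<close>, \<open>b\<close>, \<open>p\<close> in \<open>A\<close> (lemma \<open>form_Delta\<close>):
    \<open>\<Sum> c(b\<^sub>1, a\<^sub>1) c(b\<^sub>2, p\<^sub>1) c(a\<^sub>2, p\<^sub>2) = \<Sum> c(b\<^sub>1, p\<^sub>2) c(b\<^sub>2, a\<^sub>2) c(a\<^sub>1, p\<^sub>1)\<close>.
  The multiplicativity of the form in its second argument collapses the two factors containing
  \<open>b\<close> into \<open>c(\<alpha>\<^sup>2 b, p\<^sub>1 a\<^sub>1)\<close> on the left and \<open>c(\<alpha>\<^sup>2 b, a\<^sub>2 p\<^sub>2)\<close> on the right, and then the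
  identity is the braided commutativity axiom with \<open>c(\<alpha>\<^sup>2 b, -)\<close> applied to it.

  Sweedler sums are written with \<^const>\<open>tensor_lift\<close>. To compare two of them
  it is enough that both are multilinear in the tensors involved and agree on pure tensors.
\<close>

section \<open>Multilinear maps and tensor products\<close>

definition trilinear_map where
  "trilinear_map R L M N P f \<longleftrightarrow>
    (\<forall>y\<in>carrier M. \<forall>z\<in>carrier N. (\<lambda>x. f x y z) \<in> lin_maps R L P) \<and>
    (\<forall>x\<in>carrier L. \<forall>z\<in>carrier N. (\<lambda>y. f x y z) \<in> lin_maps R M P) \<and>
    (\<forall>x\<in>carrier L. \<forall>y\<in>carrier M. (\<lambda>z. f x y z) \<in> lin_maps R N P)"

lemma trilinear_mapI:
  assumes "\<And>y z. y \<in> carrier M \<Longrightarrow> z \<in> carrier N \<Longrightarrow> (\<lambda>x. f x y z) \<in> lin_maps R L P"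
    and "\<And>x z. x \<in> carrier L \<Longrightarrow> z \<in> carrier N \<Longrightarrow> (\<lambda>y. f x y z) \<in> lin_maps R M P"
    and "\<And>x y. x \<in> carrier L \<Longrightarrow> y \<in> carrier M \<Longrightarrow> (\<lambda>z. f x y z) \<in> lin_maps R N P"
  shows "trilinear_map R L M N P f"
  using assms by (simp add: trilinear_map_def)

lemma trilinear_mapD:
  assumes "trilinear_map R L M N P f"
  shows "y \<in> carrier M \<Longrightarrow> z \<in> carrier N \<Longrightarrow> (\<lambda>x. f x y z) \<in> lin_maps R L P"
    and "x \<in> carrier L \<Longrightarrow> z \<in> carrier N \<Longrightarrow> (\<lambda>y. f x y z) \<in> lin_maps R M P"
    and "x \<in> carrier L \<Longrightarrow> y \<in> carrier M \<Longrightarrow> (\<lambda>z. f x y z) \<in> lin_maps R N P"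
  using assms by (simp_all add: trilinear_map_def)

lemma lin_maps_ident: "(\<lambda>x. x) \<in> lin_maps R M M"
  by (simp add: lin_maps_def)

lemma tens_closed:
  assumes "module R M" "module R N" "x \<in> carrier M" "y \<in> carrier N"
  shows "tens R M N x y \<in> carrier (tensor R M N)"
  using lin_mapsD(1)[OF bilinear_mapD(1)[OF tens_bilinear[OF assms(1,2)] assms(3)] assms(4)] .

lemma lin_maps_tens_left:
  assumes "module R M" "module R N" "f \<in> lin_maps R X M" "y \<in> carrier N"
  shows "(\<lambda>x. tens R M N (f x) y) \<in> lin_maps R X (tensor R M N)"
  by (rule lin_maps_comp[OF assms(3) bilinear_mapD(2)[OF tens_bilinear[OF assms(1,2)] assms(4)]])

lemma lin_maps_tens_right:
  assumes "module R M" "module R N" "x \<in> carrier M" "g \<in> lin_maps R X N"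
  shows "(\<lambda>y. tens R M N x (g y)) \<in> lin_maps R X (tensor R M N)"
  by (rule lin_maps_comp[OF assms(4) bilinear_mapD(1)[OF tens_bilinear[OF assms(1,2)] assms(3)]])

lemma lin_maps_smult_left:
  assumes "module R P" "f \<in> lin_maps R X (ring_as_module R)" "p \<in> carrier P"
  shows "(\<lambda>x. f x \<odot>\<^bsub>P\<^esub> p) \<in> lin_maps R X P"
proof -
  interpret module R P by fact
  have "(\<lambda>r. r \<odot>\<^bsub>P\<^esub> p) \<in> lin_maps R (ring_as_module R) P"
    using assms(3)
    by (intro lin_mapsI) (auto simp: ring_as_module_def smult_l_distr smult_assoc1)
  from lin_maps_comp[OF assms(2) this] show ?thesis .
qed

lemma lin_maps_smult_right:
  assumes "module R P" "r \<in> carrier R" "f \<in> lin_maps R X P"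
  shows "(\<lambda>x. r \<odot>\<^bsub>P\<^esub> f x) \<in> lin_maps R X P"
proof -
  interpret module R P by fact
  have "(\<lambda>p. r \<odot>\<^bsub>P\<^esub> p) \<in> lin_maps R P P"
    using assms(2)
    by (intro lin_mapsI) (auto simp: smult_r_distr smult_assoc1[symmetric] R.m_comm)
  from lin_maps_comp[OF assms(3) this] show ?thesis .
qed

lemma lin_maps_mult_left:
  assumes "cring R" "f \<in> lin_maps R X (ring_as_module R)" "s \<in> carrier R"
  shows "(\<lambda>x. f x \<otimes>\<^bsub>R\<^esub> s) \<in> lin_maps R X (ring_as_module R)"
  using lin_maps_smult_left[OF ring_as_module_module[OF assms(1)] assms(2), of s] assms(3)
  by (simp add: ring_as_module_def)

lemma lin_maps_mult_right:
  assumes "cring R" "r \<in> carrier R" "f \<in> lin_maps R X (ring_as_module R)"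
  shows "(\<lambda>x. r \<otimes>\<^bsub>R\<^esub> f x) \<in> lin_maps R X (ring_as_module R)"
  using lin_maps_smult_right[OF ring_as_module_module[OF assms(1)] assms(2,3)]
  by (simp add: ring_as_module_def)

lemma tensor_lift_closed:
  assumes "module R M" "module R N" "module R P" "bilinear_map R M N P b"
    and "t \<in> carrier (tensor R M N)"
  shows "tensor_lift R M N P b t \<in> carrier P"
  by (rule lin_mapsD(1)[OF tensor_lift_lin[OF assms(1-4)] assms(5)])

lemma lin_maps_tensor_lift:
  assumes "module R M" "module R N" "module R P" "bilinear_map R M N P b"
    and "t \<in> lin_maps R X (tensor R M N)"
  shows "(\<lambda>x. tensor_lift R M N P b (t x)) \<in> lin_maps R X P"
  by (rule lin_maps_comp[OF assms(5) tensor_lift_lin[OF assms(1-4)]])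

lemma lin_map_tensor_lift:
  assumes "module R M" "module R N" "module R P" "module R Q"
    and f: "f \<in> lin_maps R P Q" and b: "bilinear_map R M N P b"
    and t: "t \<in> carrier (tensor R M N)"
  shows "f (tensor_lift R M N P b t) = tensor_lift R M N Q (\<lambda>x y. f (b x y)) t"
proof -
  have fb: "bilinear_map R M N Q (\<lambda>x y. f (b x y))"
    by (rule bilinear_mapI)
      (blast intro: lin_maps_comp[OF bilinear_mapD(1)[OF b] f] lin_maps_comp[OF bilinear_mapD(2)[OF b] f])+
  show ?thesis
    by (rule tensor_lin_eqI[OF assms(1,2,4) lin_maps_comp[OF tensor_lift_lin[OF assms(1-3) b] f]
          tensor_lift_lin[OF assms(1,2,4) fb] _ t])
      (simp add: tensor_lift_tens[OF assms(1-3) b] tensor_lift_tens[OF assms(1,2,4) fb])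
qed

lemma tensor_lift_cong:
  assumes "module R M" "module R N" "module R P" and b: "bilinear_map R M N P b"
    and eq: "\<And>x y. x \<in> carrier M \<Longrightarrow> y \<in> carrier N \<Longrightarrow> b x y = b' x y"
    and t: "t \<in> carrier (tensor R M N)"
  shows "tensor_lift R M N P b t = tensor_lift R M N P b' t"
proof -
  interpret M: module R M by fact
  interpret N: module R N by fact
  have b': "bilinear_map R M N P b'"
    using b eq by (auto simp: bilinear_map_def lin_maps_def Pi_iff)
  show ?thesis
    by (rule tensor_lin_eqI[OF assms(1-3) tensor_lift_lin[OF assms(1-3) b]
          tensor_lift_lin[OF assms(1-3) b'] _ t])
      (simp add: tensor_lift_tens[OF assms(1-3) b] tensor_lift_tens[OF assms(1-3) b'] eq)
qed

lemma tensor_lift_tensor_map: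
  assumes "module R M" "module R N" "module R P" "module R Q" "module R S"
    and f: "f \<in> lin_maps R M P" and g: "g \<in> lin_maps R N Q"
    and b: "bilinear_map R P Q S b" and t: "t \<in> carrier (tensor R M N)"
  shows "tensor_lift R P Q S b (tensor_map R M N P Q f g t) =
    tensor_lift R M N S (\<lambda>x y. b (f x) (g y)) t"
proof -
  have fb: "bilinear_map R M N S (\<lambda>x y. b (f x) (g y))"
    by (rule bilinear_mapI)
      (blast intro: lin_maps_comp[OF g bilinear_mapD(1)[OF b]] lin_maps_comp[OF f bilinear_mapD(2)[OF b]]
        lin_mapsD(1)[OF f] lin_mapsD(1)[OF g])+
  show ?thesis
    by (rule tensor_lin_eqI[OF assms(1,2,5)
          lin_maps_comp[OF tensor_map_lin[OF assms(1-4) f g] tensor_lift_lin[OF assms(3-5) b]]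
          tensor_lift_lin[OF assms(1,2,5) fb] _ t])
      (simp add: tensor_map_tens[OF assms(1-4) f g] tensor_lift_tens[OF assms(3-5) b] 
        lin_mapsD(1)[OF f] lin_mapsD(1)[OF g] tensor_lift_tens[OF assms(1,2,5) fb])
qed

lemma tensor_bilin_eqI:
  assumes "module R L" "module R L'" "module R M" "module R M'" "module R P"
    and f: "bilinear_map R (tensor R L L') (tensor R M M') P f"
    and g: "bilinear_map R (tensor R L L') (tensor R M M') P g"
    and eq: "\<And>x x' y y'. x \<in> carrier L \<Longrightarrow> x' \<in> carrier L' \<Longrightarrow> y \<in> carrier M \<Longrightarrow> y' \<in> carrier M' \<Longrightarrow>
      f (tens R L L' x x') (tens R M M' y y') = g (tens R L L' x x') (tens R M M' y y')"
    and s: "s \<in> carrier (tensor R L L')" and t: "t \<in> carrier (tensor R M M')"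
  shows "f s t = g s t"
  by (rule tensor_lin_eqI[OF assms(1,2,5) bilinear_mapD(2)[OF f t] bilinear_mapD(2)[OF g t] _ s],
      rule tensor_lin_eqI[OF assms(3,4,5) bilinear_mapD(1)[OF f] bilinear_mapD(1)[OF g] _ t])
    (simp_all add: eq tens_closed assms(1-4))

lemma tensor_trilin_eqI:
  assumes "module R L" "module R L'" "module R M" "module R M'" "module R N" "module R N'" "module R P"
    and f: "trilinear_map R (tensor R L L') (tensor R M M') (tensor R N N') P f"
    and g: "trilinear_map R (tensor R L L') (tensor R M M') (tensor R N N') P g"
    and eq: "\<And>x x' y y' z z'. x \<in> carrier L \<Longrightarrow> x' \<in> carrier L' \<Longrightarrow> y \<in> carrier M \<Longrightarrow> y' \<in> carrier M' \<Longrightarrow>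
      z \<in> carrier N \<Longrightarrow> z' \<in> carrier N' \<Longrightarrow>
      f (tens R L L' x x') (tens R M M' y y') (tens R N N' z z') =
      g (tens R L L' x x') (tens R M M' y y') (tens R N N' z z')"
    and r: "r \<in> carrier (tensor R L L')" and s: "s \<in> carrier (tensor R M M')"
    and t: "t \<in> carrier (tensor R N N')"
  shows "f r s t = g r s t"
proof (rule tensor_lin_eqI[OF assms(1,2,7) trilinear_mapD(1)[OF f s t] trilinear_mapD(1)[OF g s t] _ r])
  fix x x' assume x: "x \<in> carrier L" "x' \<in> carrier L'"
  have xx: "tens R L L' x x' \<in> carrier (tensor R L L')" by (intro tens_closed assms x)
  have b: "bilinear_map R (tensor R M M') (tensor R N N') P (h (tens R L L' x x'))"
    if "trilinear_map R (tensor R L L') (tensor R M M') (tensor R N N') P h" for h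
    by (rule bilinear_mapI) (intro trilinear_mapD[OF that] xx; assumption)+
  show "f (tens R L L' x x') s t = g (tens R L L' x x') s t"
    by (rule tensor_bilin_eqI[OF assms(3-7) b[OF f] b[OF g] _ s t]) (simp add: eq x)
qed

lemma tens_smult_left:
  assumes "module R M" "module R N" "r \<in> carrier R" "x \<in> carrier M" "y \<in> carrier N"
  shows "tens R M N (r \<odot>\<^bsub>M\<^esub> x) y = r \<odot>\<^bsub>tensor R M N\<^esub> tens R M N x y"
  by (rule lin_mapsD(3)[OF bilinear_mapD(2)[OF tens_bilinear[OF assms(1,2)] assms(5)] assms(3,4)])

lemma tens_smult_right:
  assumes "module R M" "module R N" "r \<in> carrier R" "x \<in> carrier M" "y \<in> carrier N"
  shows "tens R M N x (r \<odot>\<^bsub>N\<^esub> y) = r \<odot>\<^bsub>tensor R M N\<^esub> tens R M N x y"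
  by (rule lin_mapsD(3)[OF bilinear_mapD(1)[OF tens_bilinear[OF assms(1,2)] assms(4)] assms(3,5)])

lemma lin_map_double_lift:
  assumes "module R L" "module R L'" "module R M" "module R M'" "module R P" "module R Q"
    and h: "h \<in> lin_maps R P Q"
    and b: "bilinear_map R L L' P (\<lambda>x x'. tensor_lift R M M' P (b x x') t)"
      "\<And>x x'. x \<in> carrier L \<Longrightarrow> x' \<in> carrier L' \<Longrightarrow> bilinear_map R M M' P (b x x')"
    and hb: "\<And>x x' y y'. x \<in> carrier L \<Longrightarrow> x' \<in> carrier L' \<Longrightarrow> y \<in> carrier M \<Longrightarrow> y' \<in> carrier M' \<Longrightarrow>
      h (b x x' y y') = b' x x' y y'"
    and s: "s \<in> carrier (tensor R L L')" and t: "t \<in> carrier (tensor R M M')"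
  shows "h (tensor_lift R L L' P (\<lambda>x x'. tensor_lift R M M' P (b x x') t) s) =
    tensor_lift R L L' Q (\<lambda>x x'. tensor_lift R M M' Q (b' x x') t) s"
proof -
  have inner: "h (tensor_lift R M M' P (b x x') t) = tensor_lift R M M' Q (b' x x') t"
    if x: "x \<in> carrier L" "x' \<in> carrier L'" for x x'
  proof -
    have "bilinear_map R M M' Q (\<lambda>y y'. h (b x x' y y'))"
      by (rule bilinear_mapI; rule lin_maps_comp[OF _ h] ; intro bilinear_mapD[OF b(2)[OF x]])
    from tensor_lift_cong[OF assms(3,4,6) this hb[OF x] t]
    show ?thesis by (simp add: lin_map_tensor_lift[OF assms(3-6) h b(2)[OF x] t])
  qed
  have "bilinear_map R L L' Q (\<lambda>x x'. h (tensor_lift R M M' P (b x x') t))"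
    by (rule bilinear_mapI; rule lin_maps_comp[OF _ h] ; intro bilinear_mapD[OF b(1)])
  from tensor_lift_cong[OF assms(1,2,6) this inner s]
  show ?thesis by (simp add: lin_map_tensor_lift[OF assms(1,2,5,6) h b(1) s])
qed

text \<open>
  A variable of a multilinear expression occurs in it exactly once. Hence, at each node of the
  expression, the argument that contains the variable selects the rule to be used below, and plain
  repeated resolution proves that the expression depends linearly on the variable.
\<close>

lemmas multilinear_rules = lin_maps_ident
  lin_maps_tens_left lin_maps_tens_right lin_maps_smult_left lin_maps_smult_right
  lin_maps_mult_left lin_maps_mult_right lin_maps_tensor_lift tensor_lift_param
  bilinear_mapI trilinear_mapI
  tensor_map_lin assoc_l_lin assoc_r_lin
  lin_maps_comp[OF _ tensor_map_lin] lin_maps_comp[OF _ assoc_l_lin] lin_maps_comp[OF _ assoc_r_lin]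

lemmas tensor_closed = tens_closed tensor_lift_closed module.smult_closed
  lin_mapsD(1)[OF tensor_map_lin] lin_mapsD(1)[OF assoc_l_lin] lin_mapsD(1)[OF assoc_r_lin]

lemma assoc_l_assoc_r:
  assumes L: "module R L" and M: "module R M" and N: "module R N"
    and t: "t \<in> carrier (tensor R (tensor R L M) N)"
  shows "assoc_l R L M N (assoc_r R L M N t) = t"
proof (rule tensor_lin_eqI[OF tensor_module[OF L M] N _ _ lin_maps_ident _ t])
  fix u z assume u: "u \<in> carrier (tensor R L M)" and z: "z \<in> carrier N"
  show "assoc_l R L M N (assoc_r R L M N (tens R (tensor R L M) N u z)) = tens R (tensor R L M) N u z"
    by (rule tensor_lin_eqI[OF L M _ _ _ _ u];
      ((rule multilinear_rules tensor_closed tensor_module L M N z | assumption)+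
        | simp add: assoc_r_tens assoc_l_tens L M N z))
qed (rule multilinear_rules tensor_module L M N)+

section \<open>A comodule over a cobraided Hom-bialgebra\<close>

locale cobraided_comodule =
  cobraided_hom_bialgebra R A mu Delta alpha cb + hom_comodule R A Delta alpha V alphaV rho
  for R :: "'r ring" and A :: "('r, 'a) module" and V :: "('r, 'v) module"
    and mu Delta alpha cb alphaV rho +
  assumes invariant: "invariant_form R A alpha cb"
begin

abbreviation AA where "AA \<equiv> tensor R A A"
abbreviation AV where "AV \<equiv> tensor R A V"
abbreviation AAV where "AAV \<equiv> tensor R AA V"
abbreviation VV where "VV \<equiv> tensor R V V"
abbreviation VVV where "VVV \<equiv> tensor R V VV"
abbreviation K where "K \<equiv> ring_as_module R"
abbreviation c where "c a b \<equiv> cb (tens R A A a b)"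
abbreviation alpha_AV where "alpha_AV \<equiv> tensor_map R A V A V alpha alphaV"
abbreviation alpha_VV where "alpha_VV \<equiv> tensor_map R V V V V alphaV alphaV"

lemma module_A: "module R A" by (rule module_axioms)
lemma module_V: "module R V" by (rule M.module_axioms)
lemma module_K: "module R K" by (rule ring_as_module_module[OF is_cring])

lemma carrier_K: "carrier K = carrier R"
  by (simp add: ring_as_module_def)

lemma cb_closed: "t \<in> carrier AA \<Longrightarrow> cb t \<in> carrier R"
  using lin_mapsD(1)[OF cb_lin] carrier_K by auto

lemmas mods = module_A module_V module_K tensor_module

lemmas closed = cb_closed tensor_closed m_closed
  lin_mapsD(1)[OF alpha_lin] lin_mapsD(1)[OF mu_lin] lin_mapsD(1)[OF Delta_lin]
  lin_mapsD(1)[OF alphaM_lin] lin_mapsD(1)[OF rho_lin]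

lemmas lin = multilinear_rules is_cring
  alpha_lin mu_lin Delta_lin alphaM_lin rho_lin cb_lin
  lin_maps_comp[OF _ alpha_lin] lin_maps_comp[OF _ mu_lin] lin_maps_comp[OF _ Delta_lin]
  lin_maps_comp[OF _ alphaM_lin] lin_maps_comp[OF _ rho_lin] lin_maps_comp[OF _ cb_lin]
  closed mods

section \<open>The scalar identity\<close>

lemma invariant_c: "c (alpha a) (alpha b) = c a b" if "a \<in> carrier A" "b \<in> carrier A"
  using invariant that unfolding invariant_form_def
  by (simp add: closed mods tensor_map_tens alpha_lin)

text \<open>The factors of both forms below that involve their first argument.\<close>

definition cb_pair where
  "cb_pair s a p = tensor_lift R A A K (\<lambda>b1 b2. c b1 a \<otimes>\<^bsub>R\<^esub> c b2 p) s"

lemma cb_pair_trilinear: "trilinear_map R AA A A K cb_pair"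
  unfolding cb_pair_def by (rule lin | assumption)+

lemma cb_pair_closed: "cb_pair s a p \<in> carrier R"
  if "s \<in> carrier AA" "a \<in> carrier A" "p \<in> carrier A"
  using lin_mapsD(1)[OF trilinear_mapD(1)[OF cb_pair_trilinear]] that by (simp add: carrier_K)

lemma cb_pair_tens: "cb_pair (tens R A A b1 b2) a p = c b1 a \<otimes>\<^bsub>R\<^esub> c b2 p"
  if "b1 \<in> carrier A" "b2 \<in> carrier A" "a \<in> carrier A" "p \<in> carrier A"
  unfolding cb_pair_def using that by (-, subst tensor_lift_tens) (rule lin | assumption | rule refl)+

text \<open>
  The multiplicativity axiom has \<open>\<alpha>\<close> in the second arguments on its right-hand side. Stated for
  \<open>\<alpha> b\<close> instead of \<open>b\<close>, it has \<open>\<alpha>\<close> in the first ones as well, and invariance removes both.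
\<close>

lemma cb_pair_Delta: "cb_pair (Delta b) a p = c (alpha (alpha b)) (mu (tens R A A p a))"
  if "b \<in> carrier A" "a \<in> carrier A" "p \<in> carrier A"
proof -
  have "c (alpha (alpha b)) (mu (tens R A A p a)) = cb_pair (Delta (alpha b)) (alpha a) (alpha p)"
    unfolding cb_pair_def using that by (intro cb_mu_right closed)
  also have "\<dots> = tensor_lift R A A K
      (\<lambda>b1 b2. c (alpha b1) (alpha a) \<otimes>\<^bsub>R\<^esub> c (alpha b2) (alpha p)) (Delta b)"
    unfolding cb_pair_def alpha_Delta[OF that(1), symmetric] using that
    by (intro tensor_lift_tensor_map) (rule lin | assumption)+
  also have "\<dots> = cb_pair (Delta b) a p"
    unfolding cb_pair_def using that
    by (intro tensor_lift_cong) (rule lin | assumption | simp add: invariant_c)+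
  finally show ?thesis ..
qed

lemmas cb_pair_linear =
  lin_maps_comp[OF _ trilinear_mapD(1)[OF cb_pair_trilinear]]
  lin_maps_comp[OF _ trilinear_mapD(2)[OF cb_pair_trilinear]]
  lin_maps_comp[OF _ trilinear_mapD(3)[OF cb_pair_trilinear]]

text \<open>
  The order of the sums leaves the one over \<open>s\<close> innermost, where it forms a \<open>cb_pair\<close>, so that
  no interchange of sums is needed later.
\<close>

definition form_left where
  "form_left s t r = tensor_lift R A A K (\<lambda>a1 a2. tensor_lift R A A K (\<lambda>p1 p2.
    c a2 p2 \<otimes>\<^bsub>R\<^esub> cb_pair s a1 p1) r) t"

definition form_right where
  "form_right s t r = tensor_lift R A A K (\<lambda>a1 a2. tensor_lift R A A K (\<lambda>p1 p2.
    c a1 p1 \<otimes>\<^bsub>R\<^esub> cb_pair s p2 a2) r) t"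

lemma form_left_trilinear: "trilinear_map R AA AA AA K form_left"
  unfolding form_left_def by (rule cb_pair_closed cb_pair_linear lin | assumption)+

lemma form_right_trilinear: "trilinear_map R AA AA AA K form_right"
  unfolding form_right_def by (rule cb_pair_closed cb_pair_linear lin | assumption)+

lemma form_left_tens:
  "form_left (tens R A A b1 b2) (tens R A A a1 a2) (tens R A A p1 p2) =
    c a2 p2 \<otimes>\<^bsub>R\<^esub> (c b1 a1 \<otimes>\<^bsub>R\<^esub> c b2 p1)"
  if "a1 \<in> carrier A" "a2 \<in> carrier A" "b1 \<in> carrier A" "b2 \<in> carrier A"
    "p1 \<in> carrier A" "p2 \<in> carrier A"
  unfolding form_left_def using that
  by - ((rule trans[OF tensor_lift_tens],
    (rule cb_pair_closed cb_pair_linear lin | assumption)+)+, simp add: cb_pair_tens)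

lemma form_right_tens:
  "form_right (tens R A A b1 b2) (tens R A A a1 a2) (tens R A A p1 p2) =
    c a1 p1 \<otimes>\<^bsub>R\<^esub> (c b1 p2 \<otimes>\<^bsub>R\<^esub> c b2 a2)"
  if "a1 \<in> carrier A" "a2 \<in> carrier A" "b1 \<in> carrier A" "b2 \<in> carrier A"
    "p1 \<in> carrier A" "p2 \<in> carrier A"
  unfolding form_right_def using that
  by - ((rule trans[OF tensor_lift_tens],
    (rule cb_pair_closed cb_pair_linear lin | assumption)+)+, simp add: cb_pair_tens)

text \<open>
  Both sides are \<open>c(\<alpha>\<^sup>2 b, -)\<close> applied to one side of the braided commutativity axiom for \<open>a\<close> and
  \<open>p\<close>.
\<close>

lemma form_Delta:
  assumes b: "b \<in> carrier A" and a: "a \<in> carrier A" and p: "p \<in> carrier A"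
  shows "form_left (Delta b) (Delta a) (Delta p) = form_right (Delta b) (Delta a) (Delta p)"
proof -
  let ?h = "\<lambda>m. c (alpha (alpha b)) m"
  have ab: "alpha (alpha b) \<in> carrier A" using b by (intro closed)
  have h: "?h \<in> lin_maps R A K" by (rule lin ab)+
  have h_smult: "?h (r \<odot>\<^bsub>A\<^esub> m) = r \<otimes>\<^bsub>R\<^esub> ?h m" if "r \<in> carrier R" "m \<in> carrier A" for r m
    using lin_mapsD(3)[OF h that] by (simp add: ring_as_module_def)
  have "form_left (Delta b) (Delta a) (Delta p) =
      ?h (tensor_lift R A A A (\<lambda>a1 a2. tensor_lift R A A A (\<lambda>p1 p2.
        c a2 p2 \<odot>\<^bsub>A\<^esub> mu (tens R A A p1 a1)) (Delta p)) (Delta a))"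
    unfolding form_left_def
    by (rule lin_map_double_lift[symmetric, OF module_A module_A module_A module_A module_A module_K h];
      ((rule lin assms | assumption)+ | simp add: cb_pair_Delta h_smult closed mods b))
  also have "\<dots> = ?h (tensor_lift R A A A (\<lambda>a1 a2. tensor_lift R A A A (\<lambda>p1 p2.
        c a1 p1 \<odot>\<^bsub>A\<^esub> mu (tens R A A a2 p2)) (Delta p)) (Delta a))"
    by (simp add: cb_commute a p)
  also have "\<dots> = form_right (Delta b) (Delta a) (Delta p)"
    unfolding form_right_def
    by (rule lin_map_double_lift[OF module_A module_A module_A module_A module_A module_K h];
      ((rule lin assms | assumption)+ | simp add: cb_pair_Delta h_smult closed mods b))
  finally show ?thesis .
qed

section \<open>Twisted tensors scaled by a trilinear form\<close>

text \<open>
  Both sides of the Hom-Yang-Baxter equation are values of the next map at the same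
  arguments, for two different forms \<open>f\<close>.
\<close>

definition scaled_tensor where
  "scaled_tensor f m n l =
    tensor_lift R AA V VVV (\<lambda>s y. tensor_lift R AA V VVV (\<lambda>t x. tensor_lift R AA V VVV (\<lambda>r z.
      f s t r \<odot>\<^bsub>VVV\<^esub> tens R V VV (alphaV y) (tens R V V (alphaV x) (alphaV z))) l) n) m"

context
  fixes f assumes f: "trilinear_map R AA AA AA K f"
begin

lemma form_closed: "f s t r \<in> carrier R"
  if "s \<in> carrier AA" "t \<in> carrier AA" "r \<in> carrier AA"
  using lin_mapsD(1)[OF trilinear_mapD(1)[OF f]] that by (simp add: carrier_K)

lemmas form_linear =
  lin_maps_comp[OF _ trilinear_mapD(1)[OF f]]
  lin_maps_comp[OF _ trilinear_mapD(2)[OF f]]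
  lin_maps_comp[OF _ trilinear_mapD(3)[OF f]]

lemma scaled_tensor_trilinear: "trilinear_map R AAV AAV AAV VVV (scaled_tensor f)"
  unfolding scaled_tensor_def by (rule form_closed form_linear lin | assumption)+

lemma scaled_tensor_tens:
  "scaled_tensor f (tens R AA V s y) (tens R AA V t x) (tens R AA V r z) =
    f s t r \<odot>\<^bsub>VVV\<^esub> tens R V VV (alphaV y) (tens R V V (alphaV x) (alphaV z))"
  if "s \<in> carrier AA" "t \<in> carrier AA" "r \<in> carrier AA"
    "x \<in> carrier V" "y \<in> carrier V" "z \<in> carrier V"
  unfolding scaled_tensor_def using that
  by - ((rule trans[OF tensor_lift_tens], (rule form_closed form_linear lin | assumption)+)+, rule refl)

lemmas scaled_tensor_linear =
  lin_maps_comp[OF _ trilinear_mapD(1)[OF scaled_tensor_trilinear]]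
  lin_maps_comp[OF _ trilinear_mapD(2)[OF scaled_tensor_trilinear]]
  lin_maps_comp[OF _ trilinear_mapD(3)[OF scaled_tensor_trilinear]]

end

text \<open>
  In general the two forms differ on \<open>A \<otimes> A\<close>, but \<open>\<Delta> \<otimes> \<alpha>\<close> feeds them with comultiplied arguments only,
  and there they agree.
\<close>

lemma scaled_tensor_left_eq_right:
  assumes t: "t \<in> carrier AV" and s: "s \<in> carrier AV" and r: "r \<in> carrier AV"
  defines "E \<equiv> tensor_map R A V AA V Delta alphaV"
  shows "scaled_tensor form_left (E t) (E s) (E r) = scaled_tensor form_right (E t) (E s) (E r)"
    (is "?l t s r = ?r t s r")
  by (rule tensor_trilin_eqI[where f = ?l and g = ?r,
        OF module_A module_V module_A module_V module_A module_V _ _ _ _ t s r], unfold E_def;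
    ((rule scaled_tensor_linear[OF form_left_trilinear]
        scaled_tensor_linear[OF form_right_trilinear] lin | assumption)+
      | simp add: tensor_map_tens mods Delta_lin alphaM_lin scaled_tensor_tens closed
          form_left_trilinear form_right_trilinear form_Delta))

section \<open>The braiding\<close>

abbreviation B where "B \<equiv> braiding R A cb V rho"

text \<open>
  The braiding is \<open>\<rho> \<otimes> \<rho>\<close> followed by this map, which has the advantage over the braiding that
  its values on pure tensors contain no coaction.
\<close>

definition braid where
  "braid s t = tensor_lift R A V VV (\<lambda>a x. tensor_lift R A V VV (\<lambda>b y.
    c b a \<odot>\<^bsub>VV\<^esub> tens R V V y x) t) s"

lemma braid_bilinear: "bilinear_map R AV AV VV braid"
  unfolding braid_def by (rule lin | assumption)+

lemma braid_closed: "s \<in> carrier AV \<Longrightarrow> t \<in> carrier AV \<Longrightarrow> braid s t \<in> carrier VV"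
  using lin_mapsD(1)[OF bilinear_mapD(1)[OF braid_bilinear]] .

lemma braid_tens: "braid (tens R A V a x) (tens R A V b y) = c b a \<odot>\<^bsub>VV\<^esub> tens R V V y x"
  if "a \<in> carrier A" "b \<in> carrier A" "x \<in> carrier V" "y \<in> carrier V"
  unfolding braid_def using that
  by - ((rule trans[OF tensor_lift_tens], (rule lin | assumption)+)+, rule refl)

lemmas braid_linear =
  lin_maps_comp[OF _ bilinear_mapD(1)[OF braid_bilinear]]
  lin_maps_comp[OF _ bilinear_mapD(2)[OF braid_bilinear]]

lemma B_lin: "B \<in> lin_maps R VV VV"
  by (rule braiding_lin[OF module_A module_V cb_lin rho_lin])

lemma B_tens: "B (tens R V V v w) = braid (rho v) (rho w)" if "v \<in> carrier V" "w \<in> carrier V"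
  unfolding braid_def by (rule braiding_tens[OF module_A module_V cb_lin rho_lin that])

lemma braid_alpha:
  assumes s: "s \<in> carrier AV" and t: "t \<in> carrier AV"
  shows "braid (alpha_AV s) (alpha_AV t) = alpha_VV (braid s t)" (is "?l s t = ?r s t")
  by (rule tensor_bilin_eqI[where f = ?l and g = ?r,
        OF module_A module_V module_A module_V _ _ _ _ s t];
    ((rule braid_linear braid_closed lin | assumption)+
      | simp add: tensor_map_tens mods alphaM_lin alpha_lin braid_tens closed invariant_c
          lin_mapsD(3)[OF tensor_map_lin]))

lemma B_alpha: "B (alpha_VV t) = alpha_VV (B t)" if t: "t \<in> carrier VV"
  by (rule tensor_lin_eqI[OF module_V module_V _ _ _ _ t];
    ((rule B_lin lin_maps_comp[OF _ B_lin] lin | assumption)+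
      | simp add: tensor_map_tens mods alphaM_lin B_tens closed braid_alpha rho_alpha[symmetric]))

definition B23 where "B23 = tensor_map R V VV V VV alphaV B"
definition B12 where
  "B12 t = assoc_r R V V V (tensor_map R VV V VV V B alphaV (assoc_l R V V V t))"

lemma B23_lin: "B23 \<in> lin_maps R VVV VVV"
  unfolding B23_def by (rule B_lin lin)+

lemma B12_lin: "B12 \<in> lin_maps R VVV VVV"
  unfolding B12_def by (rule lin_maps_comp[OF _ B_lin] B_lin lin)+

lemma B23_tens: "B23 (tens R V VV x t) = tens R V VV (alphaV x) (B t)"
  if "x \<in> carrier V" "t \<in> carrier VV"
  unfolding B23_def using that by (simp add: tensor_map_tens mods B_lin alphaM_lin)

lemma B12_tens: "B12 (tens R V VV x (tens R V V y z)) =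
    assoc_r R V V V (tens R VV V (braid (rho x) (rho y)) (alphaV z))"
  if "x \<in> carrier V" "y \<in> carrier V" "z \<in> carrier V"
  unfolding B12_def using that
  by (simp add: assoc_l_tens tensor_map_tens mods B_lin alphaM_lin closed B_tens)

lemmas B_linear = B_lin B23_lin B12_lin
  lin_maps_comp[OF _ B_lin] lin_maps_comp[OF _ B23_lin] lin_maps_comp[OF _ B12_lin]

section \<open>The two sides of the Hom-Yang-Baxter equation\<close>

text \<open>
  The second braiding of either side acts on one input vector that has not coacted yet. In the
  following versions this vector is replaced by its coaction, an element of \<open>A \<otimes> V\<close>, so that all
  three inputs can be taken to be pure tensors.
\<close>

definition coacted_B12 where
  "coacted_B12 r m = tensor_lift R V V VVV (\<lambda>y x.
    assoc_r R V V V (tens R VV V (braid r (rho y)) (alphaV x))) m"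
definition coacted_B23 where
  "coacted_B23 m t = tensor_lift R V V VVV (\<lambda>x z.
    tens R V VV (alphaV x) (braid (rho z) t)) m"

lemma coacted_B12_bilinear: "bilinear_map R AV VV VVV coacted_B12"
  unfolding coacted_B12_def by (rule braid_closed braid_linear lin | assumption)+

lemma coacted_B23_bilinear: "bilinear_map R VV AV VVV coacted_B23"
  unfolding coacted_B23_def by (rule braid_closed braid_linear lin | assumption)+

lemma coacted_B12_tens:
  "coacted_B12 r (tens R V V y x) = assoc_r R V V V (tens R VV V (braid r (rho y)) (alphaV x))"
  if "r \<in> carrier AV" "x \<in> carrier V" "y \<in> carrier V"
  unfolding coacted_B12_def using that
  by - (rule trans[OF tensor_lift_tens],
    (rule braid_closed braid_linear lin | assumption)+, rule refl)

lemma coacted_B23_tens: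
  "coacted_B23 (tens R V V x z) t = tens R V VV (alphaV x) (braid (rho z) t)"
  if "t \<in> carrier AV" "x \<in> carrier V" "z \<in> carrier V"
  unfolding coacted_B23_def using that
  by - (rule trans[OF tensor_lift_tens],
    (rule braid_closed braid_linear lin | assumption)+, rule refl)

lemmas coacted_B_linear =
  lin_maps_comp[OF _ bilinear_mapD(1)[OF coacted_B12_bilinear]]
  lin_maps_comp[OF _ bilinear_mapD(2)[OF coacted_B12_bilinear]]
  lin_maps_comp[OF _ bilinear_mapD(1)[OF coacted_B23_bilinear]]
  lin_maps_comp[OF _ bilinear_mapD(2)[OF coacted_B23_bilinear]]

lemma B12_eq_coacted: "B12 (tens R V VV u m) = coacted_B12 (rho u) m"
  if u: "u \<in> carrier V" and m: "m \<in> carrier VV"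
  by (rule tensor_lin_eqI[OF module_V module_V _ _ _ _ m];
    ((rule u coacted_B_linear B_linear lin | assumption)+
      | simp add: u B12_tens coacted_B12_tens closed mods))

lemma B23_eq_coacted:
  "B23 (assoc_r R V V V (tens R VV V m (alphaV w))) = coacted_B23 m (alpha_AV (rho w))"
  if w: "w \<in> carrier V" and m: "m \<in> carrier VV"
  by (rule tensor_lin_eqI[OF module_V module_V _ _ _ _ m];
    ((rule w coacted_B_linear B_linear lin | assumption)+
      | simp add: w B23_tens coacted_B23_tens assoc_r_tens B_tens rho_alpha closed mods
          alphaM_lin alpha_lin))

text \<open>
  The last two braidings of either side. The second braiding pairs the \<open>A\<close>-component of a vector
  that coacts for the second time, here any element \<open>t\<close> or \<open>r\<close> of \<open>A \<otimes> V\<close>, with the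
  \<open>A\<close>-component \<open>p\<close> or \<open>b\<close> of the vector that did not take part in the first braiding. Up to
  \<open>\<alpha>\<close>, \<open>m\<close> is the value of the last braiding.
\<close>

definition left_tail where
  "left_tail p t m = tensor_lift R A V VVV (\<lambda>q y.
    c q p \<odot>\<^bsub>VVV\<^esub> tens R V VV (alphaV y) (alpha_VV m)) t"
definition right_tail where
  "right_tail b r m = tensor_lift R A V VVV (\<lambda>q z.
    c b q \<odot>\<^bsub>VVV\<^esub> assoc_r R V V V (tens R VV V (alpha_VV m) (alphaV z))) r"

lemma left_tail_trilinear: "trilinear_map R A AV VV VVV left_tail"
  unfolding left_tail_def by (rule lin | assumption)+

lemma right_tail_trilinear: "trilinear_map R A AV VV VVV right_tail"
  unfolding right_tail_def by (rule lin | assumption)+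

lemma left_tail_tens:
  "left_tail p (tens R A V q y) m = c q p \<odot>\<^bsub>VVV\<^esub> tens R V VV (alphaV y) (alpha_VV m)"
  if "p \<in> carrier A" "q \<in> carrier A" "y \<in> carrier V" "m \<in> carrier VV"
  unfolding left_tail_def using that
  by - (rule trans[OF tensor_lift_tens], (rule lin | assumption)+, rule refl)

lemma right_tail_tens: "right_tail b (tens R A V q z) m =
    c b q \<odot>\<^bsub>VVV\<^esub> assoc_r R V V V (tens R VV V (alpha_VV m) (alphaV z))"
  if "b \<in> carrier A" "q \<in> carrier A" "z \<in> carrier V" "m \<in> carrier VV"
  unfolding right_tail_def using that
  by - (rule trans[OF tensor_lift_tens], (rule lin | assumption)+, rule refl)

lemmas tail_linear =
  lin_maps_comp[OF _ trilinear_mapD(2)[OF left_tail_trilinear]]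
  lin_maps_comp[OF _ trilinear_mapD(3)[OF left_tail_trilinear]]
  lin_maps_comp[OF _ trilinear_mapD(2)[OF right_tail_trilinear]]
  lin_maps_comp[OF _ trilinear_mapD(3)[OF right_tail_trilinear]]

lemmas smult_out = lin_mapsD(3)[OF assoc_r_lin] lin_mapsD(3)[OF tensor_map_lin]
  lin_mapsD(3)[OF B23_lin] lin_mapsD(3)[OF B12_lin]
  lin_mapsD(3)[OF bilinear_mapD(1)[OF coacted_B12_bilinear]]
  lin_mapsD(3)[OF bilinear_mapD(2)[OF coacted_B23_bilinear]]
  lin_mapsD(3)[OF trilinear_mapD(3)[OF left_tail_trilinear]]
  lin_mapsD(3)[OF trilinear_mapD(3)[OF right_tail_trilinear]]
  tens_smult_left tens_smult_right

lemma B23_braid: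
  assumes "p \<in> carrier A" "x \<in> carrier V" "z \<in> carrier V" and t: "t \<in> carrier AV"
  shows "B23 (assoc_r R V V V (tens R VV V (braid (tens R A V p (alphaV z)) t) (alphaV x))) =
    left_tail p t (braid (rho z) (rho x))"
  by (rule tensor_lin_eqI[OF module_A module_V _ _ _ _ t];
    ((rule assms tail_linear B_linear braid_closed braid_linear lin | assumption)+
      | simp add: assms B23_tens B_tens left_tail_tens braid_tens smult_out mods closed
          braid_closed braid_alpha assoc_r_tens alphaM_lin rho_alpha[symmetric]))

lemma B12_braid:
  assumes "b \<in> carrier A" "x \<in> carrier V" "y \<in> carrier V" and r: "r \<in> carrier AV"
  shows "B12 (tens R V VV (alphaV x) (braid r (tens R A V b (alphaV y)))) =
    right_tail b r (braid (rho x) (rho y))"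
  by (rule tensor_lin_eqI[OF module_A module_V _ _ _ _ r];
    ((rule assms tail_linear B_linear braid_closed braid_linear lin | assumption)+
      | simp add: assms B12_tens right_tail_tens braid_tens smult_out mods closed
          braid_closed braid_alpha alphaM_lin rho_alpha[symmetric]))

lemma scaled_tensor_left:
  assumes A: "a \<in> carrier A" "b \<in> carrier A" "p \<in> carrier A"
    and t: "t \<in> carrier AV" and s: "s \<in> carrier AV" and r: "r \<in> carrier AV"
  shows "scaled_tensor form_left (assoc_l R A A V (tens R A AV b t))
      (assoc_l R A A V (tens R A AV a s)) (assoc_l R A A V (tens R A AV p r)) =
    c b a \<odot>\<^bsub>VVV\<^esub> left_tail p t (braid r s)" (is "?l t s r = ?r t s r")
  by (rule tensor_trilin_eqI[where f = ?l and g = ?r,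
        OF module_A module_V module_A module_V module_A module_V _ _ _ _ t s r];
    ((rule A tail_linear braid_closed scaled_tensor_linear[OF form_left_trilinear]
        braid_linear lin | assumption)+
      | simp add: A assoc_l_tens scaled_tensor_tens form_left_trilinear form_left_tens
          left_tail_tens braid_tens smult_out mods closed tensor_map_tens alphaM_lin
          module.smult_assoc1[of R, symmetric] m_ac))

lemma scaled_tensor_right:
  assumes A: "a \<in> carrier A" "b \<in> carrier A" "p \<in> carrier A"
    and t: "t \<in> carrier AV" and s: "s \<in> carrier AV" and r: "r \<in> carrier AV"
  shows "scaled_tensor form_right (assoc_l R A A V (tens R A AV b t))
      (assoc_l R A A V (tens R A AV a s)) (assoc_l R A A V (tens R A AV p r)) =
    c a p \<odot>\<^bsub>VVV\<^esub> right_tail b r (braid s t)" (is "?l t s r = ?r t s r")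
  by (rule tensor_trilin_eqI[where f = ?l and g = ?r,
        OF module_A module_V module_A module_V module_A module_V _ _ _ _ t s r];
    ((rule A tail_linear braid_closed scaled_tensor_linear[OF form_right_trilinear]
        braid_linear lin | assumption)+
      | simp add: A assoc_l_tens scaled_tensor_tens form_right_trilinear form_right_tens
          right_tail_tens braid_tens smult_out mods closed tensor_map_tens alphaM_lin
          assoc_r_tens module.smult_assoc1[of R, symmetric] m_ac))

abbreviation double_coaction where
  "double_coaction t \<equiv> assoc_l R A A V (tensor_map R A V A AV alpha rho t)"

text \<open>
  For pure tensors \<open>b \<otimes> y\<close> and \<open>a \<otimes> x\<close> in the place of \<open>t\<close> and \<open>s\<close>, the first braiding
  contributes \<open>c(b, a)\<close>. The double coaction twists the component of the first coaction, so
  that the form contains \<open>c(\<alpha> b, \<alpha> a)\<close> instead; by invariance these are equal. The right-hand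
  side differs only in which two vectors meet first.
\<close>

lemma left_side:
  assumes t: "t \<in> carrier AV" and s: "s \<in> carrier AV" and r: "r \<in> carrier AV"
  shows "B23 (coacted_B12 (alpha_AV r) (braid s t)) =
    scaled_tensor form_left (double_coaction t) (double_coaction s) (double_coaction r)"
    (is "?l t s r = ?r t s r")
  by (rule tensor_trilin_eqI[where f = ?l and g = ?r,
        OF module_A module_V module_A module_V module_A module_V _ _ _ _ t s r];
    ((rule coacted_B_linear B_linear braid_closed scaled_tensor_linear[OF form_left_trilinear]
        braid_linear lin | assumption)+
      | simp add: tensor_map_tens scaled_tensor_left B23_braid coacted_B12_tens braid_tens
          invariant_c smult_out mods closed braid_closed alphaM_lin alpha_lin rho_lin))

lemma right_side:
  assumes t: "t \<in> carrier AV" and s: "s \<in> carrier AV" and r: "r \<in> carrier AV"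
  shows "B12 (coacted_B23 (braid r s) (alpha_AV t)) =
    scaled_tensor form_right (double_coaction t) (double_coaction s) (double_coaction r)"
    (is "?l t s r = ?r t s r")
  by (rule tensor_trilin_eqI[where f = ?l and g = ?r,
        OF module_A module_V module_A module_V module_A module_V _ _ _ _ t s r];
    ((rule coacted_B_linear B_linear braid_closed scaled_tensor_linear[OF form_right_trilinear]
        braid_linear lin | assumption)+
      | simp add: tensor_map_tens scaled_tensor_right B12_braid coacted_B23_tens braid_tens
          invariant_c smult_out mods closed braid_closed alphaM_lin alpha_lin rho_lin))

lemma double_coaction_eq:
  "double_coaction (rho v) = tensor_map R A V AA V Delta alphaV (rho v)" if "v \<in> carrier V"
  unfolding rho_coassoc[OF that, symmetric]
  by (rule assoc_l_assoc_r) (rule lin that)+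

lemma hom_yang_baxter_tens:
  assumes "u \<in> carrier V" "v \<in> carrier V" "w \<in> carrier V"
  shows "B23 (B12 (B23 (tens R V VV u (tens R V V v w)))) =
    B12 (B23 (B12 (tens R V VV u (tens R V V v w))))"
proof -
  let ?E = double_coaction
  have "B23 (B12 (B23 (tens R V VV u (tens R V V v w)))) =
      B23 (coacted_B12 (alpha_AV (rho u)) (braid (rho v) (rho w)))"
    using assms by (simp add: B23_tens B_tens closed mods B12_eq_coacted braid_closed rho_alpha)
  also have "\<dots> = scaled_tensor form_left (?E (rho w)) (?E (rho v)) (?E (rho u))"
    using assms by (intro left_side closed)
  also have "\<dots> = scaled_tensor form_right (?E (rho w)) (?E (rho v)) (?E (rho u))"
    using assms scaled_tensor_left_eq_right[of "rho w" "rho v" "rho u"]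
    by (simp add: double_coaction_eq closed)
  also have "\<dots> = B12 (coacted_B23 (braid (rho u) (rho v)) (alpha_AV (rho w)))"
    using assms by (intro right_side[symmetric] closed)
  also have "\<dots> = B12 (B23 (B12 (tens R V VV u (tens R V V v w))))"
    using assms by (simp add: B12_tens B23_eq_coacted closed braid_closed)
  finally show ?thesis .
qed

lemma hom_yang_baxter: "B23 (B12 (B23 t)) = B12 (B23 (B12 t))" if t: "t \<in> carrier VVV"
proof (rule tensor_lin_eqI[OF module_V _ _ _ _ _ t])
  fix u m assume u: "u \<in> carrier V" and m: "m \<in> carrier VV"
  show "B23 (B12 (B23 (tens R V VV u m))) = B12 (B23 (B12 (tens R V VV u m)))"
    by (rule tensor_lin_eqI[OF module_V module_V _ _ _ _ m];
      (rule u B_linear lin | assumption | rule hom_yang_baxter_tens)+)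
qed (rule B_linear lin)+

end

theorem corollary7p5:
  fixes R :: "'r ring" and A :: "('r, 'a) module" and V :: "('r, 'v) module"
    and mu :: "('a \<times> 'a \<Rightarrow> 'r) set \<Rightarrow> 'a"
    and Delta :: "'a \<Rightarrow> ('a \<times> 'a \<Rightarrow> 'r) set"
    and alpha :: "'a \<Rightarrow> 'a"
    and cb :: "('a \<times> 'a \<Rightarrow> 'r) set \<Rightarrow> 'r"
    and alphaV :: "'v \<Rightarrow> 'v"
    and rho :: "'v \<Rightarrow> ('a \<times> 'v \<Rightarrow> 'r) set"
  assumes "cobraided_hom_bialgebra R A mu Delta alpha cb"
    and "invariant_form R A alpha cb"
    and "hom_comodule R A Delta alpha V alphaV rho"
  shows "hybe_solution R V alphaV (braiding R A cb V rho)"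
proof -
  interpret cobraided_comodule R A V mu Delta alpha cb alphaV rho
    by (intro cobraided_comodule.intro cobraided_comodule_axioms.intro assms)
  show ?thesis
    using hom_yang_baxter B_alpha B_lin
    by (simp add: hybe_solution_def Let_def B23_def B12_def)
qed
end
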